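(* Let $q$ be a nonzero complex number and $n\ge 1$. In the quantum matrix algebra $M_q(2n+1)$, the quantum determinant of order $2n+1$ is a quantum Pfaffian of order $n+1$: $${\det}_q(a_{ij})_{1\le i,j\le 2n+1}=[1,2,\dots,2n,2n+1,2n+2],$$ where the right-hand side is the quantum Pfaffian built from the entries $$[i,j]=b_{ij}=\sum_{m=1}^n\bigl(a_{2m-1,i}a_{2m,j}-q\,a_{2m-1,j}a_{2m,i}\bigr)\quad(1\le i<j\le 2n+1),$$ $$[i,2n+2]=a_{2n+1,i}\quad(1\le i\le 2n+1).$$
   Context: $M_q(N)$ is the unital associative complex algebra generated by $a_{ij}$, $1\le i,j\le N$, subject to the relations, for all $i<j$ and $k<l$: $a_{ik}a_{il}=qa_{il}a_{ik}$, $a_{ik}a_{jk}=qa_{jk}a_{ik}$, $a_{jk}a_{il}=a_{il}a_{jk}$, $a_{ik}a_{jl}-a_{jl}a_{ik}=(q-q^{-1})a_{il}a_{jk}$. The quantum determinant is ${\det}_q(a_{ij})_{1\le i,j\le N}=\sum_{\sigma\in S_N}(-q)^{l(\sigma)}a_{1,\sigma(1)}\cdots a_{N,\sigma(N)}$, with $l(\sigma)$ the number of inversions of $\sigma$. Quantum Pfaffian of order $p$: given elements $[i,j]$ ($1\le i<j\le 2p$) of an associative algebra, define $[s_1,\dots,s_{2t}]$ for $s_1<\cdots<s_{2t}$ in $\{1,\dots,2p\}$ inductively, for $t\ge2$, by $[s_1,\dots,s_{2t}]=\sum_{j=2}^{2t}(-q)^{j-2}[s_1,s_j]\,[s_2,\dots,\widehat{s_j},\dots,s_{2t}]$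 (hat means omitted). The quantum Pfaffian is $[1,2,\dots,2p]$. *)

theory Defs
  imports
    Complex_Main
    "HOL-Library.Poly_Mapping"
    "HOL-Combinatorics.Permutations"
    "HOL-Algebra.Module"
    "HOL-Algebra.QuotRing"
begin

section \<open>Free complex algebras\<close>

text \<open>
  Words under concatenation, written additively: a finitely supported function on a
  \<^class>\<open>monoid_add\<close> then carries the convolution product of the library, which is the
  multiplication of the free algebra. (A type of its own, so that no \<open>+\<close> is put on lists.)
\<close>

datatype 'x word = Word (letters: "'x list")

instantiation word :: (type) monoid_add
begin

definition zero_word :: "'a word" where
  "0 = Word []"

definition plus_word :: "'a word \<Rightarrow> 'a word \<Rightarrow> 'a word" where
  "v + w = Word (letters v @ letters w)"

instance
  by standard (simp_all add: zero_word_def plus_word_def)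

end

type_synonym 'x ncpoly = "'x word \<Rightarrow>\<^sub>0 complex"

definition scalar :: "complex \<Rightarrow> 'x ncpoly" where
  "scalar c = Poly_Mapping.single 0 c"

definition var :: "'x \<Rightarrow> 'x ncpoly" where
  "var x = Poly_Mapping.single (Word [x]) 1"

definition free_algebra :: "'x set \<Rightarrow> (complex, 'x ncpoly) module" where
  "free_algebra X =
     \<lparr>carrier = {f. \<forall>w \<in> Poly_Mapping.keys f. set (letters w) \<subseteq> X},
      monoid.mult = (*), one = 1, ring.zero = 0, add = (+),
      smult = (\<lambda>c f. scalar c * f)\<rparr>"

lemma set_letters_plus: "set (letters (v + w)) = set (letters v) \<union> set (letters w)"
  by (simp add: plus_word_def)

lemma free_algebra_mult_closed:
  assumes "f \<in> carrier (free_algebra X)" "g \<in> carrier (free_algebra X)"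
  shows "f * g \<in> carrier (free_algebra X)"
  using assms keys_mult[of f g] unfolding free_algebra_def
  by (fastforce simp: set_letters_plus)

lemma scalar_closed: "scalar c \<in> carrier (free_algebra X)"
  by (simp add: free_algebra_def scalar_def zero_word_def)

lemma var_closed: "x \<in> X \<Longrightarrow> var x \<in> carrier (free_algebra X)"
  by (simp add: free_algebra_def var_def)

lemma free_algebra_diff_closed:
  assumes "f \<in> carrier (free_algebra X)" "g \<in> carrier (free_algebra X)"
  shows "f - g \<in> carrier (free_algebra X)"
  using assms keys_diff[of f g] unfolding free_algebra_def by fastforce

lemma ring_free_algebra: "ring (free_algebra X)"
proof (rule ringI)
  show "abelian_group (free_algebra X)"
  proof (rule abelian_groupI)
    fix f g assume "f \<in> carrier (free_algebra X)" "g \<in> carrier (free_algebra X)"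
    then show "f \<oplus>\<^bsub>free_algebra X\<^esub> g \<in> carrier (free_algebra X)"
      using Poly_Mapping.keys_add[of f g] unfolding free_algebra_def by fastforce
  next
    fix f assume "f \<in> carrier (free_algebra X)"
    then show "\<exists>g\<in>carrier (free_algebra X). g \<oplus>\<^bsub>free_algebra X\<^esub> f = \<zero>\<^bsub>free_algebra X\<^esub>"
      by (intro bexI[of _ "- f"]) (auto simp: free_algebra_def)
  qed (simp_all add: free_algebra_def add_ac)
  show "monoid (free_algebra X)"
  proof (rule monoidI)
    fix f g assume "f \<in> carrier (free_algebra X)" "g \<in> carrier (free_algebra X)"
    then have "f * g \<in> carrier (free_algebra X)"
      by (rule free_algebra_mult_closed)
    then show "f \<otimes>\<^bsub>free_algebra X\<^esub> g \<in> carrier (free_algebra X)"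
      by (simp add: free_algebra_def)
  qed (simp_all add: free_algebra_def zero_word_def mult.assoc)
qed (simp_all add: free_algebra_def distrib_left distrib_right)

section \<open>Quotient algebras\<close>

definition quotient_algebra ::
    "(complex, 'b) module \<Rightarrow> 'b set \<Rightarrow> (complex, 'b set) module" where
  "quotient_algebra A I =
     \<lparr>carrier = carrier (A Quot I), monoid.mult = monoid.mult (A Quot I), one = one (A Quot I),
      ring.zero = ring.zero (A Quot I), add = add (A Quot I),
      smult = (\<lambda>c Y. \<Union>y\<in>Y. I +>\<^bsub>A\<^esub> (c \<odot>\<^bsub>A\<^esub> y))\<rparr>"

lemma ring_quotient_algebra:
  assumes "ideal I A"
  shows "ring (quotient_algebra A I)"
proof -
  interpret Q: ring "A Quot I"
    by (rule ideal.quotient_is_ring[OF assms])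
  show ?thesis
  proof (rule ringI)
    show "abelian_group (quotient_algebra A I)"
      by (rule abelian_groupI)
        (auto simp: quotient_algebra_def Q.a_ac intro: Q.add.l_inv_ex)
    show "monoid (quotient_algebra A I)"
      by (rule monoidI) (auto simp: quotient_algebra_def Q.m_assoc)
  qed (auto simp: quotient_algebra_def Q.l_distr Q.r_distr)
qed

section \<open>The quantum matrix algebra\<close>

text \<open>
  The generator \<open>a\<^sub>i\<^sub>j\<close> is the variable \<open>(i, j)\<close>. Each relation is imposed
  for all indices that occur in it: the first one for every row \<open>i\<close>, the second one for every
  column \<open>k\<close>, the last rows and columns included.
\<close>

definition quantum_matrix_relations :: "complex \<Rightarrow> nat \<Rightarrow> (nat \<times> nat) ncpoly set" where
  "quantum_matrix_relations q N =
     {var (i, k) * var (i, l) - scalar q * (var (i, l) * var (i, k)) | i k l.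
        i \<in> {1..N} \<and> k \<in> {1..N} \<and> l \<in> {1..N} \<and> k < l} \<union>
     {var (i, k) * var (j, k) - scalar q * (var (j, k) * var (i, k)) | i j k.
        i \<in> {1..N} \<and> j \<in> {1..N} \<and> k \<in> {1..N} \<and> i < j} \<union>
     {var (j, k) * var (i, l) - var (i, l) * var (j, k) | i j k l.
        i \<in> {1..N} \<and> j \<in> {1..N} \<and> k \<in> {1..N} \<and> l \<in> {1..N} \<and> i < j \<and> k < l} \<union>
     {var (i, k) * var (j, l) - var (j, l) * var (i, k)
        - scalar (q - inverse q) * (var (i, l) * var (j, k)) | i j k l.
        i \<in> {1..N} \<and> j \<in> {1..N} \<and> k \<in> {1..N} \<and> l \<in> {1..N} \<and> i < j \<and> k < l}"

definition free_matrix_algebra :: "nat \<Rightarrow> (complex, (nat \<times> nat) ncpoly) module" where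
  "free_matrix_algebra N = free_algebra ({1..N} \<times> {1..N})"

definition quantum_matrix_ideal :: "complex \<Rightarrow> nat \<Rightarrow> (nat \<times> nat) ncpoly set" where
  "quantum_matrix_ideal q N =
     Idl\<^bsub>free_matrix_algebra N\<^esub> (quantum_matrix_relations q N)"

definition quantum_matrix_algebra ::
    "complex \<Rightarrow> nat \<Rightarrow> (complex, (nat \<times> nat) ncpoly set) module" where
  "quantum_matrix_algebra q N =
     quotient_algebra (free_matrix_algebra N) (quantum_matrix_ideal q N)"

definition quantum_matrix_gen :: "complex \<Rightarrow> nat \<Rightarrow> nat \<Rightarrow> nat \<Rightarrow> (nat \<times> nat) ncpoly set" where
  "quantum_matrix_gen q N i j =
     quantum_matrix_ideal q N +>\<^bsub>free_matrix_algebra N\<^esub> var (i, j)"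

lemma quantum_matrix_relations_closed:
  "quantum_matrix_relations q N \<subseteq> carrier (free_matrix_algebra N)"
  unfolding quantum_matrix_relations_def free_matrix_algebra_def
  by (auto intro!: free_algebra_diff_closed free_algebra_mult_closed scalar_closed var_closed)

lemma ideal_quantum_matrix_ideal: "ideal (quantum_matrix_ideal q N) (free_matrix_algebra N)"
  unfolding quantum_matrix_ideal_def
  using ring.genideal_ideal[OF _ quantum_matrix_relations_closed] ring_free_algebra
  by (metis free_matrix_algebra_def)

lemma ring_quantum_matrix_algebra: "ring (quantum_matrix_algebra q N)"
  unfolding quantum_matrix_algebra_def
  by (rule ring_quotient_algebra[OF ideal_quantum_matrix_ideal])

lemma quantum_matrix_gen_closed:
  assumes "i \<in> {1..N}" "j \<in> {1..N}"
  shows "quantum_matrix_gen q N i j \<in> carrier (quantum_matrix_algebra q N)"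
  using assms var_closed[of "(i, j)" "{1..N} \<times> {1..N}"]
  by (auto simp: quantum_matrix_gen_def quantum_matrix_algebra_def quotient_algebra_def
      FactRing_def A_RCOSETS_def' free_matrix_algebra_def)

section \<open>Quantum determinant and quantum Pfaffian\<close>

definition inversions :: "nat \<Rightarrow> (nat \<Rightarrow> nat) \<Rightarrow> nat" where
  "inversions N \<sigma> = card {(i, j). 1 \<le> i \<and> i < j \<and> j \<le> N \<and> \<sigma> i > \<sigma> j}"

text \<open>The fold is the product \<open>a 1 (\<sigma> 1) \<otimes> \<dots> \<otimes> a N (\<sigma> N)\<close>, in this order.\<close>

definition quantum_det ::
    "(complex, 'b) module \<Rightarrow> complex \<Rightarrow> nat \<Rightarrow> (nat \<Rightarrow> nat \<Rightarrow> 'b) \<Rightarrow> 'b" where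
  "quantum_det A q N a =
     (\<Oplus>\<^bsub>A\<^esub>\<sigma> \<in> {\<sigma>. \<sigma> permutes {1..N}}.
        (- q) ^ inversions N \<sigma> \<odot>\<^bsub>A\<^esub>
          foldr (\<otimes>\<^bsub>A\<^esub>) (map (\<lambda>i. a i (\<sigma> i)) [1..<N + 1]) \<one>\<^bsub>A\<^esub>)"

text \<open>
  \<open>pfaffian_bracket A q e t s\<close> is \<open>[s\<^sub>1, \<dots>, s\<^sub>2\<^sub>t]\<close> for a strictly increasing list \<open>s\<close> of
  length \<open>2t\<close>, where \<open>e i j\<close> is \<open>[i, j]\<close>. Lists are indexed from 0, so the position \<open>k\<close> below
  is \<open>j - 1\<close> for the summation index \<open>j \<in> {2..2t}\<close>, and the sign exponent \<open>j - 2\<close> is \<open>k - 1\<close>.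
  The value at \<open>t = 0\<close> is not used by any bracket with \<open>t \<ge> 1\<close>.
\<close>

fun pfaffian_bracket ::
    "(complex, 'b) module \<Rightarrow> complex \<Rightarrow> (nat \<Rightarrow> nat \<Rightarrow> 'b) \<Rightarrow> nat \<Rightarrow> nat list \<Rightarrow> 'b" where
  "pfaffian_bracket A q e 0 s = \<one>\<^bsub>A\<^esub>"
| "pfaffian_bracket A q e (Suc 0) s = e (s ! 0) (s ! 1)"
| "pfaffian_bracket A q e (Suc (Suc t)) s =
     (\<Oplus>\<^bsub>A\<^esub>k \<in> {1..<2 * Suc (Suc t)}.
        (- q) ^ (k - 1) \<odot>\<^bsub>A\<^esub>
          (e (s ! 0) (s ! k) \<otimes>\<^bsub>A\<^esub> pfaffian_bracket A q e (Suc t) (nths s (- {0, k}))))"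

definition quantum_pfaffian ::
    "(complex, 'b) module \<Rightarrow> complex \<Rightarrow> nat \<Rightarrow> (nat \<Rightarrow> nat \<Rightarrow> 'b) \<Rightarrow> 'b" where
  "quantum_pfaffian A q p e = pfaffian_bracket A q e p [1..<2 * p + 1]"

end

theory Submission
  imports Defs "HOL-Combinatorics.Multiset_Permutations"
begin

text \<open>
  For a set \<open>R\<close> of rows and a set \<open>A\<close> of columns let \<open>D(R, A)\<close> be the quantum minor, expanded
  along its first row. The relations give two facts: exchanging two adjacent rows \<open>s < r\<close> costs
  a factor \<open>- q\<close> and a repeated row gives \<open>0\<close>; and \<open>D(R, A)\<close> can be expanded along its first
  column with the entries on the left, since \<open>a\<^sub>j\<^sub>k\<close> and \<open>a\<^sub>i\<^sub>l\<close> commute for \<open>i < j\<close>, \<open>k < l\<close>.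

  Call \<open>{2m - 1, 2m}\<close> a pair of rows. The claim behind the theorem is that the bracket of a
  column set \<open>A\<close> of size \<open>2t\<close> is the sum of \<open>D(R, A)\<close> over all unions \<open>R\<close> of \<open>t\<close> pairs, and that
  the bracket of \<open>A \<union> {2n + 2}\<close> with \<open>|A| = 2t + 1\<close> is the sum of \<open>D(R \<union> {2n + 1}, A)\<close>. Both follow
  by induction on \<open>t\<close>: expanding \<open>b\<^sub>c\<^sub>y\<close> in the recursion and summing over \<open>y\<close> inserts the row \<open>2m\<close>
  with coefficient \<open>a\<^sub>2\<^sub>m\<^sub>-\<^sub>1\<^sub>,\<^sub>c\<close> and the row \<open>2m - 1\<close> with coefficient \<open>- q a\<^sub>2\<^sub>m\<^sub>,\<^sub>c\<close> on top of \<open>R\<close>. This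
  vanishes if the pair \<open>m\<close> is already in \<open>R\<close>, and otherwise yields the two terms of the
  first-column expansion of \<open>D(R \<union> {2m - 1, 2m}, A)\<close> that belong to the pair \<open>m\<close>. For the full
  column set only \<open>D({1..2n + 1}, {1..2n + 1})\<close> remains, which is the quantum determinant.
\<close>

section \<open>Quantum minors modulo the relations\<close>

text \<open>The exponent of \<open>Q\<close> in all expansions: putting \<open>x\<close> in front of
  the other elements of \<open>A\<close> creates one inversion for each smaller element.
  \<open>x\<close> itself may lie in \<open>A\<close> or not.\<close>

definition rank :: "nat set \<Rightarrow> nat \<Rightarrow> nat" where
  "rank A x = card {y \<in> A. y < x}"

lemma rank_remove_ge: "x \<le> y \<Longrightarrow> rank (A - {y}) x = rank A x"
  unfolding rank_def by (rule arg_cong[where f = card]) auto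

lemma rank_remove_less:
  assumes "finite A" "x \<in> A" "x < y"
  shows "rank A y = Suc (rank (A - {x}) y)"
proof -
  have "{z \<in> A. z < y} = insert x {z \<in> A - {x}. z < y}" using assms by auto
  then show ?thesis unfolding rank_def using assms by simp
qed

lemma rank_insert_less:
  assumes "finite A" "x \<notin> A" "x < y"
  shows "rank (insert x A) y = Suc (rank A y)"
  using rank_remove_less[of "insert x A" x y] assms by simp

lemma rank_insert_ge: "y \<le> x \<Longrightarrow> rank (insert x A) y = rank A y"
  unfolding rank_def by (rule arg_cong[where f = card]) auto

lemma rank_eq_0: "(\<And>y. y \<in> A \<Longrightarrow> x \<le> y) \<Longrightarrow> rank A x = 0"
  unfolding rank_def by (metis (no_types, lifting) card.empty empty_Collect_eq not_le)

text \<open>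
  Calculations take place in the free algebra \<open>'r\<close>, modulo the ideal \<open>I\<close> of its subalgebra \<open>C\<close>;
  \<open>Q\<close> is the scalar \<open>- q\<close>.
\<close>

locale quantum_matrix_congruence =
  fixes C I :: "'r::ring_1 set" and Q :: 'r and a :: "nat \<Rightarrow> nat \<Rightarrow> 'r" and N :: nat
  assumes one_C: "1 \<in> C" and zero_C: "0 \<in> C"
    and add_C: "f \<in> C \<Longrightarrow> g \<in> C \<Longrightarrow> f + g \<in> C"
    and mult_C: "f \<in> C \<Longrightarrow> g \<in> C \<Longrightarrow> f * g \<in> C"
    and Q_C: "Q \<in> C"
    and a_C: "i \<in> {1..N} \<Longrightarrow> j \<in> {1..N} \<Longrightarrow> a i j \<in> C"
    and zero_I: "0 \<in> I"
    and add_I: "f \<in> I \<Longrightarrow> g \<in> I \<Longrightarrow> f + g \<in> I"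
    and uminus_I: "f \<in> I \<Longrightarrow> - f \<in> I"
    and left_I: "h \<in> C \<Longrightarrow> f \<in> I \<Longrightarrow> h * f \<in> I"
    and right_I: "h \<in> C \<Longrightarrow> f \<in> I \<Longrightarrow> f * h \<in> I"
    and Q_central: "Q * f = f * Q"
    and same_row: "i \<in> {1..N} \<Longrightarrow> k \<in> {1..N} \<Longrightarrow> l \<in> {1..N} \<Longrightarrow> k < l \<Longrightarrow>
      a i k * a i l + Q * (a i l * a i k) \<in> I"
    and antidiagonal: "i \<in> {1..N} \<Longrightarrow> j \<in> {1..N} \<Longrightarrow> k \<in> {1..N} \<Longrightarrow> l \<in> {1..N} \<Longrightarrow> i < j \<Longrightarrow> k < l \<Longrightarrow>
      a j k * a i l - a i l * a j k \<in> I"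
    and two_rows: "i \<in> {1..N} \<Longrightarrow> j \<in> {1..N} \<Longrightarrow> k \<in> {1..N} \<Longrightarrow> l \<in> {1..N} \<Longrightarrow> i < j \<Longrightarrow> k < l \<Longrightarrow>
      (a j k * a i l + Q * (a j l * a i k)) - Q * (a i k * a j l + Q * (a i l * a j k)) \<in> I"
begin

section \<open>Congruence modulo the ideal, and normal forms for powers of \<open>Q\<close>\<close>

definition cong :: "'r \<Rightarrow> 'r \<Rightarrow> bool" (infix "\<approx>" 50) where
  "f \<approx> g \<longleftrightarrow> f - g \<in> I"

lemma cong_refl [simp]: "f \<approx> f"
  by (simp add: cong_def zero_I)

lemma cong_sym: "f \<approx> g \<Longrightarrow> g \<approx> f"
  unfolding cong_def using uminus_I by fastforce

lemma cong_trans [trans]: "f \<approx> g \<Longrightarrow> g \<approx> h \<Longrightarrow> f \<approx> h"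
  unfolding cong_def using add_I by fastforce

lemma cong_add: "f \<approx> g \<Longrightarrow> f' \<approx> g' \<Longrightarrow> f + f' \<approx> g + g'"
  unfolding cong_def using add_I[of "f - g" "f' - g'"] by (simp add: algebra_simps)

lemma cong_sum: "(\<And>x. x \<in> A \<Longrightarrow> f x \<approx> g x) \<Longrightarrow> sum f A \<approx> sum g A"
  by (induction A rule: infinite_finite_induct) (auto intro: cong_add)

text \<open>\<open>I\<close> is an ideal of the subalgebra \<open>C\<close> only, so factors must be
  known to lie in \<open>C\<close>; the closure lemmas ending in \<open>_C\<close> serve this
  purpose. The congruent elements themselves need not lie in \<open>C\<close>.\<close>

lemma cong_mult_left: "h \<in> C \<Longrightarrow> f \<approx> g \<Longrightarrow> h * f \<approx> h * g"
  unfolding cong_def using left_I[of h "f - g"] by (simp add: algebra_simps)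

lemma cong_mult_right: "h \<in> C \<Longrightarrow> f \<approx> g \<Longrightarrow> f * h \<approx> g * h"
  unfolding cong_def using right_I[of h "f - g"] by (simp add: algebra_simps)

lemma sum_C: "(\<And>x. x \<in> A \<Longrightarrow> f x \<in> C) \<Longrightarrow> sum f A \<in> C"
  by (induction A rule: infinite_finite_induct) (auto intro: add_C zero_C)

lemma power_C: "Q ^ k \<in> C"
  by (induction k) (auto intro: one_C mult_C Q_C)

lemma Q_left: "x * (Q * y) = Q * (x * y)"
  by (metis Q_central mult.assoc)

lemma power_left: "x * (Q ^ k * y) = Q ^ k * (x * y)"
  by (induction k arbitrary: y) (simp_all add: mult.assoc Q_left)

text \<open>Restricted to generators: with \<open>x = Q\<close> the equation \<open>Q_left\<close>
  rewrites \<open>Q * (Q * y)\<close> to itself, and simplification would loop.\<close>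

lemmas Q_simps =
  Q_left[where x = "a i j" for i j] power_left[where x = "a i j" for i j]

lemma Q_collect:
  "Q * (Q ^ k * y) = Q ^ Suc k * y" "Q ^ k * (Q * y) = Q ^ Suc k * y"
  "Q ^ k * (Q ^ l * y) = Q ^ (k + l) * y"
  by (simp_all add: mult.assoc[symmetric] power_commutes power_add)

lemmas Q_normalize = Q_simps Q_collect mult.assoc sum_distrib_left add_ac[where 'a = nat]

lemma antidiagonal_cong:
  assumes "i \<in> {1..N}" "j \<in> {1..N}" "k \<in> {1..N}" "l \<in> {1..N}" "i < j" "k < l"
  shows "a j k * a i l \<approx> a i l * a j k"
  using antidiagonal[OF assms] by (simp add: cong_def)

text \<open>Rows form a list, possibly unsorted or with repetitions, so that rows can be exchanged
  and put on top; columns form a set. The base case and the empty sum make a minor with different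
  numbers of rows and columns vanish.\<close>

fun minor :: "nat list \<Rightarrow> nat set \<Rightarrow> 'r" where
  "minor [] A = (if A = {} then 1 else 0)"
| "minor (r # R) A = (\<Sum>x\<in>A. Q ^ rank A x * (a r x * minor R (A - {x})))"

lemma minor_C: "set R \<subseteq> {1..N} \<Longrightarrow> A \<subseteq> {1..N} \<Longrightarrow> minor R A \<in> C"
proof (induction R arbitrary: A)
  case (Cons r R)
  then show ?case
    by (auto intro!: sum_C mult_C power_C a_C Cons.IH)
qed (auto intro: one_C zero_C)

section \<open>Row expansions, exchange of rows and first-column expansion\<close>

lemma minor_Cons_cong:
  assumes "r \<in> {1..N}" "A \<subseteq> {1..N}"
    and "\<And>x. x \<in> A \<Longrightarrow> minor R (A - {x}) \<approx> g x"
  shows "minor (r # R) A \<approx> (\<Sum>x\<in>A. Q ^ rank A x * (a r x * g x))"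
  using assms by (auto intro!: cong_sum cong_mult_left power_C a_C)

text \<open>Expansion along the first two rows. Columns \<open>x < y\<close> can be picked in two
  orders, and the decreasing one costs one more factor \<open>Q\<close>, so the two products combine
  to a two-row minor times the rest.\<close>

lemma minor_Cons_Cons:
  assumes "finite A"
  shows "minor (r # s # R) A =
    (\<Sum>(x, y)\<in>{(x, y) \<in> A \<times> A. x < y}. Q ^ (rank A x + rank (A - {x}) y) *
      ((a r x * a s y + Q * (a r y * a s x)) * minor R (A - {x, y})))"
proof -
  define F where "F x y = Q ^ (rank A x + rank (A - {x}) y) *
      (a r x * (a s y * minor R (A - {x, y})))" for x y
  let ?P = "{(x, y) \<in> A \<times> A. x < y}"
  have fin: "finite ?P" by (rule finite_subset[OF _ finite_cartesian_product[OF assms assms]]) auto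
  have split: "(SIGMA x:A. A - {x}) = ?P \<union> prod.swap ` ?P"
    by (auto simp: image_iff)
  have "minor (r # s # R) A = (\<Sum>x\<in>A. \<Sum>y\<in>A - {x}. F x y)"
    by (simp add: F_def Q_normalize Diff_insert2[symmetric])
  also have "\<dots> = (\<Sum>(x, y)\<in>(SIGMA x:A. A - {x}). F x y)"
    using assms by (simp add: sum.Sigma)
  also have "\<dots> = (\<Sum>(x, y)\<in>?P. F x y) + (\<Sum>(x, y)\<in>prod.swap ` ?P. F x y)"
    unfolding split by (rule sum.union_disjoint) (use fin in auto)
  also have "(\<Sum>(x, y)\<in>prod.swap ` ?P. F x y) = (\<Sum>(x, y)\<in>?P. F y x)"
    by (subst sum.reindex) (auto intro!: sum.cong)
  also have "(\<Sum>(x, y)\<in>?P. F x y) + (\<Sum>(x, y)\<in>?P. F y x) =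
      (\<Sum>(x, y)\<in>?P. F x y + F y x)"
    by (simp add: sum.distrib[symmetric] case_prod_unfold)
  also have "\<dots> = (\<Sum>(x, y)\<in>?P. Q ^ (rank A x + rank (A - {x}) y) *
      ((a r x * a s y + Q * (a r y * a s x)) * minor R (A - {x, y})))"
  proof (rule sum.cong[OF refl], clarify)
    fix x y assume xy: "x \<in> A" "y \<in> A" "x < y"
    \<comment> \<open>Removing \<open>y\<close> does not change the rank of the smaller
      \<open>x\<close>, while removing \<open>x\<close> lowers the rank of \<open>y\<close> by
      one.\<close>
    have "rank A y + rank (A - {y}) x = Suc (rank A x + rank (A - {x}) y)"
      using xy assms by (simp add: rank_remove_less[of A x y] rank_remove_ge)
    then have "F y x = Q ^ (rank A x + rank (A - {x}) y) *
        (Q * (a r y * (a s x * minor R (A - {x, y}))))"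
      by (simp add: F_def insert_commute Q_normalize del: power_Suc)
    then show "F x y + F y x = Q ^ (rank A x + rank (A - {x}) y) *
      ((a r x * a s y + Q * (a r y * a s x)) * minor R (A - {x, y}))"
      by (simp add: F_def distrib_left distrib_right mult.assoc)
  qed
  finally show ?thesis .
qed

text \<open>With equal rows each two-row factor in \<open>minor_Cons_Cons\<close> is an instance of
  \<open>same_row\<close>.\<close>

lemma minor_equal_rows:
  assumes "r \<in> {1..N}" "set R \<subseteq> {1..N}" "A \<subseteq> {1..N}"
  shows "minor (r # r # R) A \<approx> 0"
proof -
  have fin: "finite A" using assms(3) finite_subset by blast
  have "minor (r # r # R) A \<approx> (\<Sum>(x, y)\<in>{(x, y) \<in> A \<times> A. x < y}.
      Q ^ (rank A x + rank (A - {x}) y) * (0 * minor R (A - {x, y})))"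
    unfolding minor_Cons_Cons[OF fin]
  proof (rule cong_sum, clarify)
    fix x y assume "x \<in> A" "y \<in> A" "x < y"
    moreover from this have "x \<in> {1..N}" "y \<in> {1..N}" using assms by blast+
    ultimately have "a r x * a r y + Q * (a r y * a r x) \<approx> 0"
      using same_row[of r x y] assms by (simp add: cong_def)
    then show "Q ^ (rank A x + rank (A - {x}) y) *
        ((a r x * a r y + Q * (a r y * a r x)) * minor R (A - {x, y})) \<approx>
      Q ^ (rank A x + rank (A - {x}) y) * (0 * minor R (A - {x, y}))"
      by (intro cong_mult_left cong_mult_right power_C minor_C) (use assms in auto)
  qed
  then show ?thesis by simp
qed

text \<open>The relation \<open>two_rows\<close> is the claim for the two-row factors in
  \<open>minor_Cons_Cons\<close>; \<open>Q\<close> is central and can be moved out of each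
  summand.\<close>

lemma minor_swap_rows:
  assumes "r \<in> {1..N}" "s \<in> {1..N}" "s < r" "set R \<subseteq> {1..N}" "A \<subseteq> {1..N}"
  shows "minor (r # s # R) A \<approx> Q * minor (s # r # R) A"
proof -
  have fin: "finite A" using assms(5) finite_subset by blast
  have "minor (r # s # R) A \<approx> (\<Sum>(x, y)\<in>{(x, y) \<in> A \<times> A. x < y}.
      Q ^ (rank A x + rank (A - {x}) y) *
        ((Q * (a s x * a r y + Q * (a s y * a r x))) * minor R (A - {x, y})))"
    unfolding minor_Cons_Cons[OF fin]
  proof (rule cong_sum, clarify)
    fix x y assume "x \<in> A" "y \<in> A" "x < y"
    moreover from this have "x \<in> {1..N}" "y \<in> {1..N}" using assms by blast+
    ultimately have "a r x * a s y + Q * (a r y * a s x) \<approx> Q * (a s x * a r y + Q * (a s y * a r x))"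
      using two_rows[of s r x y] assms by (simp add: cong_def)
    then show "Q ^ (rank A x + rank (A - {x}) y) *
        ((a r x * a s y + Q * (a r y * a s x)) * minor R (A - {x, y})) \<approx>
      Q ^ (rank A x + rank (A - {x}) y) *
        ((Q * (a s x * a r y + Q * (a s y * a r x))) * minor R (A - {x, y}))"
      by (intro cong_mult_left cong_mult_right power_C minor_C) (use assms in auto)
  qed
  also have "\<dots> = Q * minor (s # r # R) A"
    unfolding minor_Cons_Cons[OF fin] sum_distrib_left
  proof (rule sum.cong[OF refl], clarify)
    fix x y
    show "Q ^ (rank A x + rank (A - {x}) y) *
        (Q * (a s x * a r y + Q * (a s y * a r x)) * minor R (A - {x, y})) =
      Q * (Q ^ (rank A x + rank (A - {x}) y) *
        ((a s x * a r y + Q * (a s y * a r x)) * minor R (A - {x, y})))"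
      by (simp add: Q_normalize del: power_Suc)
  qed
  finally show ?thesis .
qed

text \<open>The top copy of \<open>r\<close> is moved down past the smaller rows until it meets its
  other copy; then \<open>minor_equal_rows\<close> applies.\<close>

lemma minor_repeated_row:
  assumes "sorted_wrt (<) R" "r \<in> set R" "set R \<subseteq> {1..N}" "A \<subseteq> {1..N}"
  shows "minor (r # R) A \<approx> 0"
  using assms
proof (induction R arbitrary: A)
  case (Cons s R)
  show ?case
  proof (cases "r = s")
    case True
    then show ?thesis using minor_equal_rows Cons.prems by simp
  next
    case False
    then have "s < r" "r \<in> set R" using Cons.prems by auto
    have "minor (r # s # R) A \<approx> Q * minor (s # r # R) A"
      by (rule minor_swap_rows) (use Cons.prems \<open>s < r\<close> \<open>r \<in> set R\<close> in auto)
    also have "\<dots> \<approx> Q * (\<Sum>x\<in>A. Q ^ rank A x * (a s x * 0))"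
      by (intro cong_mult_left Q_C minor_Cons_cong Cons.IH)
        (use Cons.prems \<open>r \<in> set R\<close> in auto)
    finally show ?thesis by simp
  qed
qed simp

text \<open>Each of the \<open>rank (set R) r\<close> smaller rows that \<open>r\<close> passes on
  its way down contributes one \<open>Q\<close> by \<open>minor_swap_rows\<close>.\<close>

lemma minor_insort:
  assumes "sorted_wrt (<) R" "r \<notin> set R" "r \<in> {1..N}" "set R \<subseteq> {1..N}" "A \<subseteq> {1..N}"
  shows "minor (r # R) A \<approx> Q ^ rank (set R) r * minor (insort r R) A"
  using assms
proof (induction R arbitrary: A)
  case Nil
  then show ?case by (simp add: rank_def)
next
  case (Cons s R)
  show ?case
  proof (cases "r < s")
    case True
    then have "rank (set (s # R)) r = 0" by (intro rank_eq_0) (use Cons.prems in auto)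
    then show ?thesis using True by simp
  next
    case False
    then have "s < r" using Cons.prems by auto
    then have rank: "rank (set (s # R)) r = Suc (rank (set R) r)"
      using rank_insert_less[of "set R" s r] Cons.prems by auto
    have "minor (r # s # R) A \<approx> Q * minor (s # r # R) A"
      by (rule minor_swap_rows) (use Cons.prems \<open>s < r\<close> in auto)
    also have "\<dots> \<approx> Q * (\<Sum>x\<in>A. Q ^ rank A x *
        (a s x * (Q ^ rank (set R) r * minor (insort r R) (A - {x}))))"
      by (intro cong_mult_left Q_C minor_Cons_cong Cons.IH) (use Cons.prems in auto)
    also have "\<dots> = Q * (Q ^ rank (set R) r * minor (s # insort r R) A)"
      by (simp add: Q_normalize del: power_Suc)
    finally show ?thesis using False \<open>s < r\<close> by (simp add: rank[simplified] mult.assoc del: minor.simps)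
  qed
qed

text \<open>Since \<open>c\<close> is the smallest column, an entry \<open>a s c\<close> commutes by
  \<open>antidiagonal\<close> with each entry \<open>a r x\<close> of a row above it and can be
  moved to the far left. In the induction either the first row uses column \<open>c\<close>, or the
  expansion of the remaining rows does.\<close>

lemma minor_first_column:
  assumes "sorted_wrt (<) R" "set R \<subseteq> {1..N}" "insert c A \<subseteq> {1..N}" "\<And>x. x \<in> A \<Longrightarrow> c < x"
  shows "minor R (insert c A) \<approx>
    (\<Sum>r\<in>set R. Q ^ rank (set R) r * (a r c * minor (remove1 r R) A))"
  using assms
proof (induction R arbitrary: A)
  case (Cons r R)
  have fin: "finite A" using finite_subset[OF Cons.prems(3)] by simp
  have c: "c \<notin> A" using Cons.prems(4) by (metis less_irrefl)
  have r: "r \<notin> set R" using Cons.prems(1) by auto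
  let ?t = "\<lambda>s x. Q ^ rank A x * (Q ^ rank (set R) s * (a s c * (a r x * minor (remove1 s R) (A - {x}))))"
  have step: "Q ^ rank (insert c A) x * (a r x * minor R (insert c A - {x})) \<approx> Q * (\<Sum>s\<in>set R. ?t s x)"
    if x: "x \<in> A" for x
  proof -
    have [simp]: "rank (insert c A) x = Suc (rank A x)"
      using x Cons.prems(4) fin c by (auto intro: rank_insert_less)
    have "minor R (insert c (A - {x})) \<approx>
        (\<Sum>s\<in>set R. Q ^ rank (set R) s * (a s c * minor (remove1 s R) (A - {x})))"
      by (rule Cons.IH) (use Cons.prems in auto)
    moreover have "insert c A - {x} = insert c (A - {x})" using x c by auto
    ultimately have "minor R (insert c A - {x}) \<approx>
        (\<Sum>s\<in>set R. Q ^ rank (set R) s * (a s c * minor (remove1 s R) (A - {x})))"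
      by simp
    then have "Q ^ rank (insert c A) x * (a r x * minor R (insert c A - {x})) \<approx>
        Q ^ rank (insert c A) x * (a r x *
          (\<Sum>s\<in>set R. Q ^ rank (set R) s * (a s c * minor (remove1 s R) (A - {x}))))"
      by (intro cong_mult_left power_C a_C) (use Cons.prems x in auto)
    also have "\<dots> = Q * (\<Sum>s\<in>set R. Q ^ rank A x * (Q ^ rank (set R) s *
        ((a r x * a s c) * minor (remove1 s R) (A - {x}))))"
      by (simp add: Q_normalize del: power_Suc)
    also have "\<dots> \<approx> Q * (\<Sum>s\<in>set R. Q ^ rank A x * (Q ^ rank (set R) s *
        ((a s c * a r x) * minor (remove1 s R) (A - {x}))))"
    proof (intro cong_mult_left Q_C cong_sum power_C cong_mult_right minor_C)
      fix s assume s: "s \<in> set R"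
      show "a r x * a s c \<approx> a s c * a r x"
        by (rule cong_sym, rule antidiagonal_cong) (use Cons.prems s x in auto)
      show "set (remove1 s R) \<subseteq> {1..N}"
        using Cons.prems set_remove1_subset[of s R] by auto
    qed (use Cons.prems in auto)
    finally show ?thesis by (simp add: mult.assoc)
  qed
  have "minor (r # R) (insert c A) = a r c * minor R A +
      (\<Sum>x\<in>A. Q ^ rank (insert c A) x * (a r x * minor R (insert c A - {x})))"
  proof -
    have "rank (insert c A) c = 0"
      using Cons.prems(4) by (intro rank_eq_0) (auto intro: less_imp_le)
    then show ?thesis using fin c by simp
  qed
  also have "\<dots> \<approx> a r c * minor R A + (\<Sum>x\<in>A. Q * (\<Sum>s\<in>set R. ?t s x))"
    by (intro cong_add cong_refl cong_sum step)
  also have "(\<Sum>x\<in>A. Q * (\<Sum>s\<in>set R. ?t s x)) = (\<Sum>s\<in>set R. \<Sum>x\<in>A. Q * ?t s x)"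
    unfolding sum_distrib_left by (rule sum.swap)
  also have "\<dots> = (\<Sum>s\<in>set R. Q ^ rank (set (r # R)) s * (a s c * minor (remove1 s (r # R)) A))"
  proof (rule sum.cong[OF refl])
    fix s assume s: "s \<in> set R"
    then have "r < s" using Cons.prems by auto
    \<comment> \<open>The \<open>Q\<close> that came from column \<open>c\<close> preceding
      \<open>x\<close> now accounts for the row \<open>r\<close> above \<open>s\<close>.\<close>
    then have "rank (set (r # R)) s = Suc (rank (set R) s)"
      using rank_insert_less[of "set R" r s] r by simp
    then show "(\<Sum>x\<in>A. Q * ?t s x) = Q ^ rank (set (r # R)) s * (a s c * minor (remove1 s (r # R)) A)"
      using \<open>r < s\<close>
      by (simp add: Q_normalize del: power_Suc)
  qed
  also have "a r c * minor R A + \<dots> =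
      (\<Sum>s\<in>set (r # R). Q ^ rank (set (r # R)) s * (a s c * minor (remove1 s (r # R)) A))"
  proof -
    have "rank (set (r # R)) r = 0" by (intro rank_eq_0) (use Cons.prems in auto)
    then show ?thesis using r by simp
  qed
  finally show ?case .
qed simp

end

section \<open>Sums of minors over unions of row pairs\<close>

text \<open>\<open>T\<close> consists of the indices of the pairs. Subtraction of naturals makes the
  pair of index 0 degenerate, hence the hypotheses \<open>T \<subseteq> {1..n}\<close>
  below.\<close>

definition pair_rows :: "nat set \<Rightarrow> nat set" where
  "pair_rows T = (\<Union>m\<in>T. {2 * m - 1, 2 * m})"

lemma pair_rows_insert: "pair_rows (insert m T) = insert (2 * m - 1) (insert (2 * m) (pair_rows T))"
  by (simp add: pair_rows_def)

lemma finite_pair_rows: "finite T \<Longrightarrow> finite (pair_rows T)"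
  by (simp add: pair_rows_def)

lemma pair_rows_subset: "T \<subseteq> {1..n} \<Longrightarrow> pair_rows T \<subseteq> {1..2 * n}"
  by (fastforce simp: pair_rows_def)

lemma pair_rows_notin:
  assumes "T \<subseteq> {1..n}" "m \<notin> T" "m \<ge> 1"
  shows "2 * m - 1 \<notin> pair_rows T" "2 * m \<notin> pair_rows T"
proof -
  have "k \<noteq> m \<and> k \<ge> 1" if "k \<in> T" for k
    using that assms by auto
  then show "2 * m - 1 \<notin> pair_rows T" "2 * m \<notin> pair_rows T"
    using assms(3) by (force simp: pair_rows_def; presburger)+
qed

text \<open>Distinct positive indices have disjoint pairs, and each such pair has two different
  rows.\<close>

lemma sum_pair_rows:
  assumes "T \<subseteq> {1..n}"
  shows "sum f (pair_rows T) = (\<Sum>m\<in>T. f (2 * m - 1) + f (2 * m))"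
proof -
  have "finite T" using assms finite_subset by blast
  then show ?thesis using assms
  proof (induction T)
    case (insert m T)
    then have "2 * m - 1 \<notin> pair_rows T" "2 * m \<notin> pair_rows T" "2 * m - 1 \<noteq> 2 * m"
      using pair_rows_notin[of T n m] by auto
    then show ?case
      using insert by (simp add: pair_rows_insert finite_pair_rows add.assoc)
  qed (simp add: pair_rows_def)
qed

lemma card_pair_rows:
  assumes "T \<subseteq> {1..n}"
  shows "card (pair_rows T) = 2 * card T"
  using sum_pair_rows[OF assms, of "\<lambda>_. 1 :: nat"] by simp

lemma pair_rows_atLeastAtMost: "pair_rows {1..n} = {1..2 * n}"
proof
  show "{1..2 * n} \<subseteq> pair_rows {1..n}"
  proof
    fix r assume "r \<in> {1..2 * n}"
    then have "(r + 1) div 2 \<in> {1..n}" "r = 2 * ((r + 1) div 2) - 1 \<or> r = 2 * ((r + 1) div 2)"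
      by auto
    then show "r \<in> pair_rows {1..n}" unfolding pair_rows_def by blast
  qed
qed (rule pair_rows_subset[OF subset_refl])

text \<open>Double counting: \<open>(m, T)\<close> with \<open>m \<notin> T\<close> corresponds to
  \<open>(T', m)\<close> with \<open>m \<in> T'\<close> via \<open>T' = insert m T\<close>. The zero
  summands are the cases where the pair \<open>m\<close> is already present.\<close>

lemma sum_subsets_insert:
  fixes h :: "'a \<Rightarrow> 'a set \<Rightarrow> 'b::comm_monoid_add"
  assumes "finite B"
  shows "(\<Sum>m\<in>B. \<Sum>T | T \<subseteq> B \<and> card T = t. if m \<in> T then 0 else h m (insert m T)) =
    (\<Sum>T | T \<subseteq> B \<and> card T = Suc t. \<Sum>m\<in>T. h m T)"
proof -
  have fin: "finite {T. T \<subseteq> B \<and> R T}" for R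
    using assms by (auto intro: finite_subset[of _ "Pow B"])
  have sub: "finite T" if "T \<subseteq> B" for T
    using that assms finite_subset by blast
  have "(\<Sum>m\<in>B. \<Sum>T | T \<subseteq> B \<and> card T = t. if m \<in> T then 0 else h m (insert m T)) =
      (\<Sum>m\<in>B. \<Sum>T | T \<subseteq> B \<and> card T = t \<and> m \<notin> T. h m (insert m T))"
    by (rule sum.cong[OF refl], rule sum.mono_neutral_cong_right[OF fin]) auto
  also have "\<dots> = (\<Sum>T | T \<subseteq> B \<and> card T = Suc t. \<Sum>m\<in>T. h m T)"
    using assms fin sub
    by (subst (1 2) sum.Sigma)
      (auto intro!: sum.reindex_bij_witness[where
          i = "\<lambda>(T, m). (m, T - {m})" and j = "\<lambda>(m, T). (insert m T, m)"]
        simp: insert_absorb card_Diff_singleton)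
  finally show ?thesis .
qed

section \<open>Minors on sets of rows, and the effect of inserting a pair of rows\<close>

context quantum_matrix_congruence
begin

definition row_minor :: "nat set \<Rightarrow> nat set \<Rightarrow> 'r" where
  "row_minor P A = minor (sorted_list_of_set P) A"

lemma row_minor_C: "P \<subseteq> {1..N} \<Longrightarrow> A \<subseteq> {1..N} \<Longrightarrow> row_minor P A \<in> C"
  unfolding row_minor_def using finite_subset[of P "{1..N}"] by (intro minor_C) auto

lemma row_minor_repeated_row:
  assumes "r \<in> P" "P \<subseteq> {1..N}" "A \<subseteq> {1..N}"
  shows "minor (r # sorted_list_of_set P) A \<approx> 0"
  using assms finite_subset[OF assms(2)] by (intro minor_repeated_row) auto

lemma row_minor_insert:
  assumes "r \<notin> P" "insert r P \<subseteq> {1..N}" "A \<subseteq> {1..N}"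
  shows "minor (r # sorted_list_of_set P) A \<approx> Q ^ rank P r * row_minor (insert r P) A"
proof -
  have "finite P" using finite_subset[OF assms(2)] by simp
  then show ?thesis
    using minor_insort[of "sorted_list_of_set P" r A] assms
    by (auto simp: row_minor_def)
qed

lemma row_minor_first_column:
  assumes "P \<subseteq> {1..N}" "insert c A \<subseteq> {1..N}" "\<And>x. x \<in> A \<Longrightarrow> c < x"
  shows "row_minor P (insert c A) \<approx>
    (\<Sum>r\<in>P. Q ^ rank P r * (a r c * row_minor (P - {r}) A))"
proof -
  have "finite P" using finite_subset[OF assms(1)] by simp
  then show ?thesis
    using minor_first_column[of "sorted_list_of_set P" c A] assms
    by (simp add: row_minor_def sorted_list_of_set_remove)
qed

text \<open>In the second product \<open>a j c\<close> commutes with \<open>a i y\<close>, as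
  \<open>i < j\<close> and \<open>c < y\<close>. With the entries of column \<open>c\<close> on the
  left, two first-row expansions remain, with \<open>j\<close> or \<open>i\<close> as the new top
  row.\<close>

lemma minor_pair_first_column:
  assumes "i \<in> {1..N}" "j \<in> {1..N}" "i < j" "set R \<subseteq> {1..N}"
    and "insert c A \<subseteq> {1..N}" "\<And>x. x \<in> A \<Longrightarrow> c < x"
  shows "(\<Sum>y\<in>A. Q ^ rank A y * ((a i c * a j y + Q * (a i y * a j c)) * minor R (A - {y}))) \<approx>
    a i c * minor (j # R) A + Q * (a j c * minor (i # R) A)"
proof -
  have "(\<Sum>y\<in>A. Q ^ rank A y * ((a i c * a j y + Q * (a i y * a j c)) * minor R (A - {y}))) \<approx>
      (\<Sum>y\<in>A. Q ^ rank A y * ((a i c * a j y + Q * (a j c * a i y)) * minor R (A - {y})))"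
  proof (intro cong_sum cong_mult_left power_C cong_mult_right minor_C cong_add cong_refl Q_C)
    fix y assume "y \<in> A"
    then show "a i y * a j c \<approx> a j c * a i y"
      by (intro cong_sym[OF antidiagonal_cong]) (use assms in auto)
  qed (use assms in \<open>auto intro!: a_C\<close>)
  also have "\<dots> = a i c * minor (j # R) A + Q * (a j c * minor (i # R) A)"
    by (simp add: sum.distrib[symmetric] distrib_left distrib_right Q_normalize del: power_Suc)
  finally show ?thesis .
qed

text \<open>The entries \<open>b\<^sub>i\<^sub>j\<close> before passage to cosets; \<open>Q\<close>
  stands for \<open>- q\<close>.\<close>

definition pair_form :: "nat \<Rightarrow> nat \<Rightarrow> nat \<Rightarrow> 'r" where
  "pair_form n i j = (\<Sum>m = 1..n. a (2 * m - 1) i * a (2 * m) j + Q * (a (2 * m - 1) j * a (2 * m) i))"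

text \<open>\<open>U\<close> is empty in the even case and holds the unpaired last row in the odd
  case.\<close>

definition minor_sum :: "nat \<Rightarrow> nat \<Rightarrow> nat set \<Rightarrow> nat set \<Rightarrow> 'r" where
  "minor_sum n t U A = (\<Sum>T | T \<subseteq> {1..n} \<and> card T = t. row_minor (pair_rows T \<union> U) A)"

text \<open>The right-hand side consists of the two summands for the pair \<open>m\<close> in the
  first-column expansion of \<open>row_minor P' (insert c A)\<close>. As \<open>U\<close> lies below
  all pairs, a row of the pair \<open>m\<close> is in \<open>P\<close> only if
  \<open>m \<in> T\<close>.\<close>

lemma pair_expansion:
  assumes "m \<in> {1..n}" "T \<subseteq> {1..n}" "U \<subseteq> {2 * n + 1..N}" "2 * n \<le> N"
    and "insert c A \<subseteq> {1..N}" "\<And>x. x \<in> A \<Longrightarrow> c < x"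
  defines "P \<equiv> pair_rows T \<union> U" and "P' \<equiv> pair_rows (insert m T) \<union> U"
  shows "(\<Sum>y\<in>A. Q ^ rank A y * ((a (2 * m - 1) c * a (2 * m) y + Q * (a (2 * m - 1) y * a (2 * m) c)) *
      row_minor P (A - {y}))) \<approx>
    (if m \<in> T then 0 else \<Sum>r\<in>{2 * m - 1, 2 * m}. Q ^ rank P' r * (a r c * row_minor (P' - {r}) A))"
proof -
  let ?i = "2 * m - 1" and ?j = "2 * m"
  have P: "P \<subseteq> {1..N}" using pair_rows_subset[OF assms(2)] assms(3,4) by (fastforce simp: P_def)
  have finP: "finite P" using finite_subset[OF P] by simp
  have ij: "?i \<in> {1..N}" "?j \<in> {1..N}" "?i < ?j" using assms(1,4) by auto
  have ac: "a ?i c \<in> C" "a ?j c \<in> C" using ij assms(5) by (auto intro!: a_C)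
  have "(\<Sum>y\<in>A. Q ^ rank A y * ((a ?i c * a ?j y + Q * (a ?i y * a ?j c)) * row_minor P (A - {y}))) \<approx>
      a ?i c * minor (?j # sorted_list_of_set P) A + Q * (a ?j c * minor (?i # sorted_list_of_set P) A)"
    unfolding row_minor_def
    by (rule minor_pair_first_column) (use ij P finP assms(5,6) in auto)
  also have "\<dots> \<approx>
    (if m \<in> T then 0 else \<Sum>r\<in>{2 * m - 1, 2 * m}. Q ^ rank P' r * (a r c * row_minor (P' - {r}) A))"
  proof (cases "m \<in> T")
    case True
    then have "?i \<in> P" "?j \<in> P" by (auto simp: P_def pair_rows_def)
    then have "a ?i c * minor (?j # sorted_list_of_set P) A + Q * (a ?j c * minor (?i # sorted_list_of_set P) A)
        \<approx> a ?i c * 0 + Q * (a ?j c * 0)"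
      by (intro cong_add cong_mult_left ac Q_C row_minor_repeated_row) (use P assms(5) in auto)
    then show ?thesis using True by simp
  next
    case False
    have "r \<notin> U" if "r \<le> 2 * n" for r
      using assms(3) that by auto
    then have "?i \<notin> U" "?j \<notin> U" using assms(1) by auto
    then have notin: "?i \<notin> P" "?j \<notin> P"
      using pair_rows_notin[OF assms(2) False] assms(1) by (auto simp: P_def)
    have P': "P' = insert ?i (insert ?j P)" by (simp add: P_def P'_def pair_rows_insert)
    \<comment> \<open>The rows of the pair are consecutive and not in \<open>P\<close>, so equally
      many rows of \<open>P\<close> lie above both. In \<open>P'\<close> the row
      \<open>2 * m\<close> also has \<open>2 * m - 1\<close> above it, which absorbs the factor
      \<open>Q\<close> of the second product.\<close>
    have "y < ?j \<longleftrightarrow> y < ?i \<or> y = ?i" for y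
      using assms(1) by auto
    then have rank_j: "rank P ?j = rank P ?i"
      unfolding rank_def using notin(1) by (intro arg_cong[where f = card]) blast
    have rank': "rank P' ?i = rank P ?i" "rank P' ?j = Suc (rank P ?i)"
      using ij notin finP by (simp_all add: P' rank_insert_ge rank_insert_less rank_j)
    have diff: "P' - {?i} = insert ?j P" "P' - {?j} = insert ?i P"
      using notin ij by (auto simp: P')
    have "a ?i c * minor (?j # sorted_list_of_set P) A + Q * (a ?j c * minor (?i # sorted_list_of_set P) A)
        \<approx> a ?i c * (Q ^ rank P ?j * row_minor (insert ?j P) A) +
          Q * (a ?j c * (Q ^ rank P ?i * row_minor (insert ?i P) A))"
      by (intro cong_add cong_mult_left ac Q_C row_minor_insert) (use P ij notin assms(5) in auto)
    also have "\<dots> = (\<Sum>r\<in>{?i, ?j}. Q ^ rank P' r * (a r c * row_minor (P' - {r}) A))"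
      using ij(3) by (simp add: rank' diff rank_j Q_normalize del: power_Suc One_nat_def)
    finally show ?thesis using False by simp
  qed
  finally show ?thesis .
qed

text \<open>The sum over \<open>y\<close> is pulled inside and evaluated by
  \<open>pair_expansion\<close> for each \<open>m\<close> and \<open>T\<close>;
  \<open>sum_subsets_insert\<close> regroups by the enlarged set. The result is the first-column
  expansion of \<open>minor_sum n (Suc t) U (insert c A)\<close> without the terms for the rows in
  \<open>U\<close>.\<close>

lemma pair_form_expansion:
  assumes "U \<subseteq> {2 * n + 1..N}" "2 * n \<le> N" "insert c A \<subseteq> {1..N}" "\<And>x. x \<in> A \<Longrightarrow> c < x"
  shows "(\<Sum>y\<in>A. Q ^ rank A y * (pair_form n c y * minor_sum n t U (A - {y}))) \<approx>
    (\<Sum>T | T \<subseteq> {1..n} \<and> card T = Suc t. \<Sum>r\<in>pair_rows T.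
      Q ^ rank (pair_rows T \<union> U) r * (a r c * row_minor (pair_rows T \<union> U - {r}) A))"
proof -
  let ?S = "{T. T \<subseteq> {1..n} \<and> card T = t}"
  let ?g = "\<lambda>P r. Q ^ rank P r * (a r c * row_minor (P - {r}) A)"
  let ?f = "\<lambda>m y. a (2 * m - 1) c * a (2 * m) y + Q * (a (2 * m - 1) y * a (2 * m) c)"
  define H where "H m T = (\<Sum>r\<in>{2 * m - 1, 2 * m}. ?g (pair_rows T \<union> U) r)" for m T
  have "(\<Sum>y\<in>A. Q ^ rank A y * (pair_form n c y * minor_sum n t U (A - {y}))) =
      (\<Sum>y\<in>A. \<Sum>m = 1..n. \<Sum>T\<in>?S. Q ^ rank A y * (?f m y * row_minor (pair_rows T \<union> U) (A - {y})))"
    unfolding pair_form_def minor_sum_def sum_product by (simp only: sum_distrib_left)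
  also have "\<dots> = (\<Sum>m = 1..n. \<Sum>y\<in>A. \<Sum>T\<in>?S. Q ^ rank A y * (?f m y * row_minor (pair_rows T \<union> U) (A - {y})))"
    by (rule sum.swap)
  also have "\<dots> = (\<Sum>m = 1..n. \<Sum>T\<in>?S. \<Sum>y\<in>A. Q ^ rank A y * (?f m y * row_minor (pair_rows T \<union> U) (A - {y})))"
    by (rule sum.cong[OF refl], rule sum.swap)
  finally have "(\<Sum>y\<in>A. Q ^ rank A y * (pair_form n c y * minor_sum n t U (A - {y}))) =
      (\<Sum>m = 1..n. \<Sum>T\<in>?S. \<Sum>y\<in>A. Q ^ rank A y * (?f m y * row_minor (pair_rows T \<union> U) (A - {y})))" .
  then have expand: "(\<Sum>y\<in>A. Q ^ rank A y * (pair_form n c y * minor_sum n t U (A - {y}))) \<approx>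
      (\<Sum>m = 1..n. \<Sum>T\<in>?S. if m \<in> T then 0 else H m (insert m T))"
    by (simp only: H_def) (intro cong_sum pair_expansion, use assms in auto)
  have regroup: "(\<Sum>m = 1..n. \<Sum>T\<in>?S. if m \<in> T then 0 else H m (insert m T)) =
      (\<Sum>T | T \<subseteq> {1..n} \<and> card T = Suc t. \<Sum>m\<in>T. H m T)"
    using sum_subsets_insert[of "{1..n}" H t] by simp
  have rows: "(\<Sum>m\<in>T. H m T) = (\<Sum>r\<in>pair_rows T. ?g (pair_rows T \<union> U) r)"
    if T: "T \<subseteq> {1..n}" for T
    unfolding sum_pair_rows[OF T]
  proof (rule sum.cong[OF refl])
    fix m assume "m \<in> T"
    then have "m \<ge> 1" using T by auto
    then show "H m T = ?g (pair_rows T \<union> U) (2 * m - 1) + ?g (pair_rows T \<union> U) (2 * m)"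
      by (simp add: H_def)
  qed
  show ?thesis
    using expand unfolding regroup by (simp add: rows)
qed

text \<open>With \<open>U\<close> empty, the right-hand side of \<open>pair_form_expansion\<close>
  is the complete first-column expansion.\<close>

lemma minor_sum_even:
  assumes "2 * n \<le> N" "insert c A \<subseteq> {1..N}" "\<And>x. x \<in> A \<Longrightarrow> c < x"
  shows "(\<Sum>y\<in>A. Q ^ rank A y * (pair_form n c y * minor_sum n t {} (A - {y}))) \<approx>
    minor_sum n (Suc t) {} (insert c A)"
proof -
  have "minor_sum n (Suc t) {} (insert c A) \<approx>
    (\<Sum>T | T \<subseteq> {1..n} \<and> card T = Suc t. \<Sum>r\<in>pair_rows T.
      Q ^ rank (pair_rows T \<union> {}) r * (a r c * row_minor (pair_rows T \<union> {} - {r}) A))"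
    unfolding minor_sum_def Un_empty_right
  proof (intro cong_sum row_minor_first_column)
    fix T assume "T \<in> {T. T \<subseteq> {1..n} \<and> card T = Suc t}"
    then show "pair_rows T \<subseteq> {1..N}" using pair_rows_subset[of T n] assms(1) by fastforce
  qed (use assms in auto)
  then show ?thesis
    using pair_form_expansion[of "{}" n c A t] assms by (blast intro: cong_trans cong_sym)
qed

text \<open>Besides the terms in \<open>pair_form_expansion\<close>, the first-column expansion has
  one term for the row \<open>z\<close>, which is the second summand on the left.\<close>

lemma minor_sum_odd:
  assumes "2 * n < z" "z \<le> N" "insert c A \<subseteq> {1..N}" "\<And>x. x \<in> A \<Longrightarrow> c < x"
  shows "(\<Sum>y\<in>A. Q ^ rank A y * (pair_form n c y * minor_sum n t {z} (A - {y}))) +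
      Q ^ (2 * Suc t) * (a z c * minor_sum n (Suc t) {} A) \<approx>
    minor_sum n (Suc t) {z} (insert c A)"
proof -
  let ?S = "{T. T \<subseteq> {1..n} \<and> card T = Suc t}"
  let ?g = "\<lambda>P r. Q ^ rank P r * (a r c * row_minor (P - {r}) A)"
  have T: "pair_rows T \<subseteq> {1..2 * n}" "card (pair_rows T) = 2 * Suc t" "finite (pair_rows T)"
    if "T \<in> ?S" for T
    using that pair_rows_subset[of T n] card_pair_rows[of T n] finite_subset[of T "{1..n}"]
    by (auto intro: finite_pair_rows)
  have "minor_sum n (Suc t) {z} (insert c A) \<approx>
      (\<Sum>T\<in>?S. \<Sum>r\<in>pair_rows T \<union> {z}. ?g (pair_rows T \<union> {z}) r)"
    unfolding minor_sum_def
  proof (intro cong_sum row_minor_first_column)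
    fix T assume "T \<in> ?S"
    then show "pair_rows T \<union> {z} \<subseteq> {1..N}" using T(1)[of T] assms(1,2) by fastforce
  qed (use assms in auto)
  also have "\<dots> = (\<Sum>T\<in>?S. (\<Sum>r\<in>pair_rows T. ?g (pair_rows T \<union> {z}) r) +
      Q ^ (2 * Suc t) * (a z c * row_minor (pair_rows T) A))"
  proof (rule sum.cong[OF refl])
    fix R assume R: "R \<in> ?S"
    have z: "z \<notin> pair_rows R" using T(1)[OF R] assms(1) by auto
    \<comment> \<open>\<open>z\<close> lies below all \<open>2 * Suc t\<close> rows of the pairs,
      which gives its exponent.\<close>
    have "{y \<in> pair_rows R \<union> {z}. y < z} = pair_rows R" using T(1)[OF R] assms(1) by fastforce
    then have "rank (pair_rows R \<union> {z}) z = 2 * Suc t" using T(2)[OF R] by (simp add: rank_def)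
    then show "(\<Sum>r\<in>pair_rows R \<union> {z}. ?g (pair_rows R \<union> {z}) r) =
        (\<Sum>r\<in>pair_rows R. ?g (pair_rows R \<union> {z}) r) + Q ^ (2 * Suc t) * (a z c * row_minor (pair_rows R) A)"
      using T(3)[OF R] z by (simp add: add.commute)
  qed
  also have "\<dots> = (\<Sum>T\<in>?S. \<Sum>r\<in>pair_rows T. ?g (pair_rows T \<union> {z}) r) +
      Q ^ (2 * Suc t) * (a z c * minor_sum n (Suc t) {} A)"
    by (simp add: sum.distrib minor_sum_def sum_distrib_left)
  also have "\<dots> \<approx> (\<Sum>y\<in>A. Q ^ rank A y * (pair_form n c y * minor_sum n t {z} (A - {y}))) +
      Q ^ (2 * Suc t) * (a z c * minor_sum n (Suc t) {} A)"
    by (intro cong_add cong_refl cong_sym[OF pair_form_expansion]) (use assms in auto)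
  finally show ?thesis by (rule cong_sym)
qed

text \<open>Start of the even induction: with one pair of rows and two columns, each minor is one
  summand of \<open>pair_form\<close>.\<close>

lemma minor_sum_1:
  assumes "i < j"
  shows "minor_sum n 1 {} {i, j} = pair_form n i j"
proof -
  have "{T. T \<subseteq> {1..n} \<and> card T = 1} = (\<lambda>m. {m}) ` {1..n}"
    by (auto simp: card_1_singleton_iff)
  then have "minor_sum n 1 {} {i, j} = (\<Sum>m = 1..n. row_minor (pair_rows {m}) {i, j})"
    unfolding minor_sum_def by (simp add: sum.reindex)
  also have "\<dots> = pair_form n i j"
    unfolding pair_form_def
  proof (rule sum.cong[OF refl])
    fix m assume "m \<in> {1..n}"
    then have "sorted_list_of_set (set [2 * m - 1, 2 * m]) = [2 * m - 1, 2 * m]"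
      by (intro sorted_list_of_set.idem_if_sorted_distinct) auto
    then have "sorted_list_of_set (pair_rows {m}) = [2 * m - 1, 2 * m]"
      by (simp add: pair_rows_def)
    moreover have "rank {i} i = 0" "rank {j} j = 0" "rank {i, j} i = 0" "rank {i, j} j = 1"
      using assms rank_insert_less[of "{j}" i j] rank_eq_0[of "{j}" j]
      by (auto intro!: rank_eq_0)
    moreover have "{i, j} - {i} = {j}" "{i, j} - {j} = {i}" using assms by auto
    ultimately show "row_minor (pair_rows {m}) {i, j} =
        a (2 * m - 1) i * a (2 * m) j + Q * (a (2 * m - 1) j * a (2 * m) i)"
      using assms by (simp add: row_minor_def)
  qed
  finally show ?thesis .
qed

text \<open>Start of the odd induction: no pairs, one row, one column.\<close>

lemma minor_sum_0: "minor_sum n 0 {z} {i} = a z i"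
proof -
  have "{T. T \<subseteq> {1..n} \<and> card T = 0} = {{}}"
    by (auto dest: finite_subset)
  moreover have "rank {i} i = 0" by (rule rank_eq_0) simp
  ultimately show ?thesis by (simp add: minor_sum_def pair_rows_def row_minor_def)
qed

text \<open>Only \<open>T = {1..n}\<close> has \<open>n\<close> elements, so the sum collapses to
  the minor on all rows.\<close>

lemma minor_sum_full: "minor_sum n n {2 * n + 1} A = minor [1..<2 * n + 2] A"
proof -
  have "{T. T \<subseteq> {1..n} \<and> card T = n} = {{1..n}}"
    using card_subset_eq[of "{1..n}"] by auto
  moreover have "pair_rows {1..n} \<union> {2 * n + 1} = {1..<2 * n + 2}"
    unfolding pair_rows_atLeastAtMost by auto
  ultimately show ?thesis
    unfolding minor_sum_def row_minor_def by (simp del: upt_Suc)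
qed

end

section \<open>The row expansion as a sum over permutations\<close>

text \<open>The recursion matches the first-row expansion. Passing to \<open>set xs\<close> ignores
  repetitions, so inversions are counted correctly for distinct lists, such as those given by
  permutations.\<close>

fun list_inversions :: "nat list \<Rightarrow> nat" where
  "list_inversions [] = 0"
| "list_inversions (x # xs) = rank (set xs) x + list_inversions xs"

text \<open>Inversions are split by whether their first position is \<open>m\<close>; the start
  \<open>m\<close> is arbitrary because the tail starts at \<open>Suc m\<close>.\<close>

lemma card_inversions_upt:
  assumes "inj \<sigma>"
  shows "card {(i, j). m \<le> i \<and> i < j \<and> j < m + k \<and> \<sigma> i > \<sigma> j} =
    list_inversions (map \<sigma> [m..<m + k])"
proof (induction k arbitrary: m)
  case (Suc k)
  let ?A = "Pair m ` {j. m < j \<and> j < m + Suc k \<and> \<sigma> m > \<sigma> j}"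
  let ?B = "{(i, j). Suc m \<le> i \<and> i < j \<and> j < Suc m + k \<and> \<sigma> i > \<sigma> j}"
  have "finite ?A" by simp
  moreover have "finite ?B"
    by (rule finite_subset[of _ "{..m + k} \<times> {..m + k}"]) auto
  moreover have "?A \<inter> ?B = {}" by auto
  moreover have "{(i, j). m \<le> i \<and> i < j \<and> j < m + Suc k \<and> \<sigma> i > \<sigma> j} = ?A \<union> ?B"
    by (auto simp: Suc_le_eq le_less)
  ultimately have "card {(i, j). m \<le> i \<and> i < j \<and> j < m + Suc k \<and> \<sigma> i > \<sigma> j} = card ?A + card ?B"
    by (simp add: card_Un_disjoint)
  \<comment> \<open>Injectivity turns the count of positions into a count of values, as
    \<open>rank\<close> requires.\<close>
  also have "card ?A = card (\<sigma> ` {j. m < j \<and> j < m + Suc k \<and> \<sigma> m > \<sigma> j})"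
    using assms by (simp add: card_image inj_on_def)
  also have "\<sigma> ` {j. m < j \<and> j < m + Suc k \<and> \<sigma> m > \<sigma> j} =
      {y \<in> set (map \<sigma> [Suc m..<Suc m + k]). y < \<sigma> m}"
    by auto
  also have "card \<dots> + card ?B = list_inversions (map \<sigma> (m # [Suc m..<Suc m + k]))"
    unfolding Suc.IH by (simp add: rank_def)
  also have "m # [Suc m..<Suc m + k] = [m..<m + Suc k]"
    by (simp add: upt_conv_Cons)
  finally show ?case .
qed (auto simp: card_eq_0_iff)

lemma inversions_eq_list_inversions:
  assumes "\<sigma> permutes {1..N}"
  shows "inversions N \<sigma> = list_inversions (map \<sigma> [1..<N + 1])"
  using card_inversions_upt[OF permutes_inj[OF assms], of 1 N]
  by (simp add: inversions_def less_Suc_eq_le del: upt_Suc)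

text \<open>A permutation is determined by its values on \<open>{1..N}\<close>, being the identity
  elsewhere; surjectivity follows by comparing cardinalities.\<close>

lemma bij_betw_permutations_of_set:
  "bij_betw (\<lambda>\<sigma>. map \<sigma> [1..<N + 1]) {\<sigma>. \<sigma> permutes {1..N}} (permutations_of_set {1..N})"
proof -
  let ?f = "\<lambda>\<sigma>. map \<sigma> [1..<N + 1]"
  have set: "set [1..<N + 1] = {1..N}" by auto
  have inj: "inj_on ?f {\<sigma>. \<sigma> permutes {1..N}}"
  proof (rule inj_onI, rule ext)
    fix \<sigma> \<tau> i
    assume *: "\<sigma> \<in> {\<sigma>. \<sigma> permutes {1..N}}" "\<tau> \<in> {\<sigma>. \<sigma> permutes {1..N}}" "?f \<sigma> = ?f \<tau>"
    show "\<sigma> i = \<tau> i"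
    proof (cases "i \<in> {1..N}")
      case True
      then show ?thesis using *(3) unfolding map_eq_conv set by blast
    next
      case False
      then show ?thesis using * by (simp add: permutes_not_in)
    qed
  qed
  have sub: "?f ` {\<sigma>. \<sigma> permutes {1..N}} \<subseteq> permutations_of_set {1..N}"
  proof clarify
    fix \<sigma> assume \<sigma>: "\<sigma> permutes {1..N}"
    then have "inj_on \<sigma> {1..N}" using permutes_inj inj_on_subset by blast
    then show "?f \<sigma> \<in> permutations_of_set {1..N}"
      unfolding permutations_of_set_def
      using set permutes_image[OF \<sigma>] by (simp add: distinct_map del: upt_Suc)
  qed
  have "card (?f ` {\<sigma>. \<sigma> permutes {1..N}}) = card (permutations_of_set {1..N})"
    using inj by (simp add: card_image card_permutations del: upt_Suc)
  then have "?f ` {\<sigma>. \<sigma> permutes {1..N}} = permutations_of_set {1..N}"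
    using sub by (intro card_subset_eq) auto
  then show ?thesis using inj by (simp add: bij_betw_def)
qed

context quantum_matrix_congruence
begin

text \<open>Iterated first-row expansion: a word starting with \<open>x\<close> comes from picking
  column \<open>x\<close> in the first row. The length hypothesis keeps \<open>map2\<close> from
  truncating.\<close>

lemma minor_permutations_of_set:
  assumes "finite A" "length R = card A"
  shows "minor R A = (\<Sum>w\<in>permutations_of_set A. Q ^ list_inversions w * prod_list (map2 a R w))"
  using assms
proof (induction R arbitrary: A)
  case Nil
  then show ?case by simp
next
  case (Cons r R)
  then have A: "A \<noteq> {}" by (metis card.empty length_0_conv list.discI)
  let ?t = "\<lambda>R w. Q ^ list_inversions w * prod_list (map2 a R w)"
  have "(\<Sum>w\<in>permutations_of_set A. ?t (r # R) w) =
      (\<Sum>x\<in>A. \<Sum>w\<in>(#) x ` permutations_of_set (A - {x}). ?t (r # R) w)"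
    unfolding permutations_of_set_nonempty[OF A]
    by (rule sum.UNION_disjoint) (use Cons.prems in auto)
  also have "\<dots> = (\<Sum>x\<in>A. \<Sum>w\<in>permutations_of_set (A - {x}). Q ^ rank A x * (a r x * ?t R w))"
  proof (rule sum.cong[OF refl])
    fix x assume "x \<in> A"
    have "?t (r # R) (x # w) = Q ^ rank A x * (a r x * ?t R w)"
      if "w \<in> permutations_of_set (A - {x})" for w
    proof -
      have "set w = A - {x}" using that by (simp add: permutations_of_set_def)
      then have "rank (set w) x = rank A x" by (simp add: rank_remove_ge)
      then show ?thesis by (simp add: Q_normalize)
    qed
    then show "(\<Sum>w\<in>(#) x ` permutations_of_set (A - {x}). ?t (r # R) w) =
        (\<Sum>w\<in>permutations_of_set (A - {x}). Q ^ rank A x * (a r x * ?t R w))"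
      by (subst sum.reindex) auto
  qed
  also have "\<dots> = minor (r # R) A"
  proof -
    have "minor R (A - {x}) = (\<Sum>w\<in>permutations_of_set (A - {x}). ?t R w)" if "x \<in> A" for x
      by (rule Cons.IH) (use Cons.prems that in simp_all)
    then show ?thesis by (simp add: sum_distrib_left)
  qed
  finally show ?case by simp
qed

lemma minor_permutes:
  "minor [1..<N + 1] {1..N} =
    (\<Sum>\<sigma> | \<sigma> permutes {1..N}. Q ^ inversions N \<sigma> * prod_list (map (\<lambda>i. a i (\<sigma> i)) [1..<N + 1]))"
proof -
  have "minor [1..<N + 1] {1..N} = (\<Sum>w\<in>permutations_of_set {1..N}.
      Q ^ list_inversions w * prod_list (map2 a [1..<N + 1] w))"
    by (rule minor_permutations_of_set) auto
  also have "\<dots> = (\<Sum>\<sigma> | \<sigma> permutes {1..N}. Q ^ list_inversions (map \<sigma> [1..<N + 1]) *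
      prod_list (map2 a [1..<N + 1] (map \<sigma> [1..<N + 1])))"
    by (rule sum.reindex_bij_betw[OF bij_betw_permutations_of_set, symmetric])
  also have "\<dots> = (\<Sum>\<sigma> | \<sigma> permutes {1..N}. Q ^ inversions N \<sigma> * prod_list (map (\<lambda>i. a i (\<sigma> i)) [1..<N + 1]))"
  proof (rule sum.cong[OF refl])
    have zip: "map2 a l (map \<sigma> l) = map (\<lambda>i. a i (\<sigma> i)) l" for \<sigma> l
      by (induction l) auto
    fix \<sigma> assume "\<sigma> \<in> {\<sigma>. \<sigma> permutes {1..N}}"
    then show "Q ^ list_inversions (map \<sigma> [1..<N + 1]) *
        prod_list (map2 a [1..<N + 1] (map \<sigma> [1..<N + 1])) =
      Q ^ inversions N \<sigma> * prod_list (map (\<lambda>i. a i (\<sigma> i)) [1..<N + 1])"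
      by (simp only: mem_Collect_eq inversions_eq_list_inversions zip)
  qed
  finally show ?thesis .
qed

lemma prod_list_C: "(\<And>x. x \<in> set l \<Longrightarrow> f x \<in> C) \<Longrightarrow> prod_list (map f l) \<in> C"
  by (induction l) (auto intro: one_C mult_C)

lemma pair_form_C:
  assumes "2 * n \<le> N" "i \<in> {1..N}" "j \<in> {1..N}"
  shows "pair_form n i j \<in> C"
  unfolding pair_form_def
  by (intro sum_C add_C mult_C Q_C a_C) (use assms in auto)

lemma minor_sum_C:
  assumes "2 * n \<le> N" "U \<subseteq> {1..N}" "A \<subseteq> {1..N}"
  shows "minor_sum n t U A \<in> C"
  unfolding minor_sum_def
proof (intro sum_C row_minor_C assms)
  fix T assume "T \<in> {T. T \<subseteq> {1..n} \<and> card T = t}"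
  then show "pair_rows T \<union> U \<subseteq> {1..N}"
    using pair_rows_subset[of T n] assms by fastforce
qed

end

section \<open>Passage to the quantum matrix algebra\<close>

lemma scalar_mult: "scalar c * scalar d = scalar (c * d)"
  by (simp add: scalar_def mult_single)

lemma scalar_minus: "scalar (- c) = - scalar c"
  by (simp add: scalar_def single_uminus)

lemma scalar_1: "scalar 1 = 1"
  by (simp add: scalar_def)

lemma scalar_diff: "scalar (c - d) = scalar c - scalar d"
  by (simp add: scalar_def single_diff)

lemma scalar_power: "scalar (c ^ k) = scalar c ^ k"
  by (induction k) (simp_all add: scalar_1 scalar_mult[symmetric])

text \<open>A scalar is supported on the empty word and so commutes with every monomial; the
  induction adds one monomial at a time.\<close>

lemma scalar_central: "scalar c * f = f * scalar c"
proof (induction f rule: update_induct)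
  case const
  then show ?case by simp
next
  case (update f k v)
  have "Poly_Mapping.update k v f = f + Poly_Mapping.single k v"
    using update.hyps
    by (intro poly_mapping_eqI) (auto simp: lookup_update lookup_add lookup_single in_keys_iff)
  then show ?case
    using update.IH by (simp add: distrib_left distrib_right scalar_def mult_single mult.commute)
qed

lemma free_matrix_algebra_simps [simp]:
  "monoid.mult (free_matrix_algebra N) = (*)"
  "one (free_matrix_algebra N) = 1"
  "ring.zero (free_matrix_algebra N) = 0"
  "add (free_matrix_algebra N) = (+)"
  "smult (free_matrix_algebra N) = (\<lambda>c f. scalar c * f)"
  by (simp_all add: free_matrix_algebra_def free_algebra_def)

lemma quantum_matrix_congruence_free:
  assumes "q \<noteq> 0"
  shows "quantum_matrix_congruence (carrier (free_matrix_algebra N)) (quantum_matrix_ideal q N)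
    (scalar (- q)) (\<lambda>i j. var (i, j)) N"
proof -
  let ?I = "quantum_matrix_ideal q N" and ?C = "carrier (free_matrix_algebra N)"
  interpret F: ring "free_matrix_algebra N"
    unfolding free_matrix_algebra_def by (rule ring_free_algebra)
  interpret ideal ?I "free_matrix_algebra N"
    by (rule ideal_quantum_matrix_ideal)
  have sc: "scalar c \<in> ?C" for c
    unfolding free_matrix_algebra_def by (rule scalar_closed)
  have gen: "f \<in> ?I" if "f \<in> quantum_matrix_relations q N" for f
    using that F.genideal_self[OF quantum_matrix_relations_closed]
    unfolding quantum_matrix_ideal_def by blast
  have addI: "f + g \<in> ?I" if "f \<in> ?I" "g \<in> ?I" for f g
    using a_closed[OF that] by simp
  have leftI: "h * f \<in> ?I" if "h \<in> ?C" "f \<in> ?I" for h f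
    using I_l_closed[OF that(2,1)] by simp
  have anti: "var (j, k) * var (i, l) - var (i, l) * var (j, k) \<in> ?I"
    and cross: "var (i, k) * var (j, l) - var (j, l) * var (i, k)
        - scalar (q - inverse q) * (var (i, l) * var (j, k)) \<in> ?I"
    if "i \<in> {1..N}" "j \<in> {1..N}" "k \<in> {1..N}" "l \<in> {1..N}" "i < j" "k < l" for i j k l
    by (rule gen, unfold quantum_matrix_relations_def, use that in blast)+
  show ?thesis
  proof
    show "1 \<in> ?C" using F.one_closed by simp
    show "0 \<in> ?C" using F.zero_closed by simp
    show "f + g \<in> ?C" "f * g \<in> ?C" if "f \<in> ?C" "g \<in> ?C" for f g
      using F.a_closed[OF that] F.m_closed[OF that] by simp_all
    show "scalar (- q) \<in> ?C" by (rule sc)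
    show "var (i, j) \<in> ?C" if "i \<in> {1..N}" "j \<in> {1..N}" for i j
      unfolding free_matrix_algebra_def using that by (intro var_closed) simp
    show "0 \<in> ?I" using zero_closed by simp
    show "f + g \<in> ?I" if "f \<in> ?I" "g \<in> ?I" for f g by (rule addI[OF that])
    show "- f \<in> ?I" if "f \<in> ?I" for f
      using leftI[OF sc[of "- 1"] that] by (simp add: scalar_minus scalar_1)
    show "h * f \<in> ?I" if "h \<in> ?C" "f \<in> ?I" for h f by (rule leftI[OF that])
    show "f * h \<in> ?I" if "h \<in> ?C" "f \<in> ?I" for h f
      using I_r_closed[OF that(2,1)] by simp
    show "scalar (- q) * f = f * scalar (- q)" for f by (rule scalar_central)
    show "var (i, k) * var (i, l) + scalar (- q) * (var (i, l) * var (i, k)) \<in> ?I"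
      if "i \<in> {1..N}" "k \<in> {1..N}" "l \<in> {1..N}" "k < l" for i k l
    proof -
      have "var (i, k) * var (i, l) - scalar q * (var (i, l) * var (i, k)) \<in> ?I"
        by (rule gen, unfold quantum_matrix_relations_def, use that in blast)
      then show ?thesis by (simp add: scalar_minus)
    qed
    show "var (j, k) * var (i, l) - var (i, l) * var (j, k) \<in> ?I"
      if "i \<in> {1..N}" "j \<in> {1..N}" "k \<in> {1..N}" "l \<in> {1..N}" "i < j" "k < l" for i j k l
      by (rule anti[OF that])
    show "var (j, k) * var (i, l) + scalar (- q) * (var (j, l) * var (i, k)) -
        scalar (- q) * (var (i, k) * var (j, l) + scalar (- q) * (var (i, l) * var (j, k))) \<in> ?I"
      if ijkl: "i \<in> {1..N}" "j \<in> {1..N}" "k \<in> {1..N}" "l \<in> {1..N}" "i < j" "k < l" for i j k l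
    proof -
      have "scalar q * (scalar (q - inverse q) * f) = scalar q * (scalar q * f) - f"
        for f :: "(nat \<times> nat) ncpoly"
        using assms
        by (simp add: mult.assoc[symmetric] scalar_mult right_diff_distrib)
          (simp add: scalar_diff scalar_1 left_diff_distrib)
      \<comment> \<open>\<open>two_rows\<close> is the commutation relation plus \<open>q\<close>
        times the relation with \<open>q - inverse q\<close>. The coefficients match by
        \<open>q * (q - inverse q) = q ^ 2 - 1\<close>, valid for
        \<open>q \<noteq> 0\<close>.\<close>
      then have eq: "var (j, k) * var (i, l) + scalar (- q) * (var (j, l) * var (i, k)) -
          scalar (- q) * (var (i, k) * var (j, l) + scalar (- q) * (var (i, l) * var (j, k))) =
        (var (j, k) * var (i, l) - var (i, l) * var (j, k)) +
          scalar q * (var (i, k) * var (j, l) - var (j, l) * var (i, k)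
            - scalar (q - inverse q) * (var (i, l) * var (j, k)))"
        by (simp add: scalar_minus right_diff_distrib distrib_left)
      show ?thesis
        unfolding eq by (rule addI[OF anti[OF ijkl] leftI[OF sc cross[OF ijkl]]])
    qed
  qed
qed

section \<open>From positions in sorted lists to ranks and removals in sets\<close>

lemma rank_nth:
  assumes "sorted_wrt (<) xs" "i < length xs"
  shows "rank (set xs) (xs ! i) = i"
  using assms
proof (induction xs arbitrary: i)
  case (Cons x xs)
  show ?case
  proof (cases i)
    case 0
    have "rank (set (x # xs)) x = 0" using Cons.prems by (intro rank_eq_0) auto
    then show ?thesis using 0 by simp
  next
    case (Suc j)
    then have "x < xs ! j" "x \<notin> set xs" using Cons.prems by auto
    then show ?thesis using Suc Cons by (simp add: rank_insert_less)
  qed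
qed simp

lemma nths_remove_nth:
  assumes "distinct xs" "i < length xs"
  shows "nths xs (- {i}) = remove1 (xs ! i) xs"
  using assms
proof (induction xs arbitrary: i)
  case (Cons x xs)
  show ?case
  proof (cases i)
    case 0
    then have "{j. Suc j \<in> - {i}} = UNIV" by auto
    then show ?thesis using 0 by (simp add: nths_Cons nths_all)
  next
    case (Suc j)
    then have "{k. Suc k \<in> - {i}} = - {j}" by auto
    moreover have "x \<noteq> xs ! j" using Suc Cons.prems by auto
    ultimately show ?thesis using Suc Cons by (simp add: nths_Cons)
  qed
qed simp

lemma sum_nth:
  assumes "distinct xs"
  shows "(\<Sum>k = 1..<Suc (length xs). h (xs ! (k - 1))) = sum h (set xs)"
proof -
  have "(\<Sum>k = 1..<Suc (length xs). h (xs ! (k - 1))) = (\<Sum>k<length xs. h (xs ! k))"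
    by (rule sum.reindex_bij_witness[of _ Suc "\<lambda>k. k - 1"]) auto
  also have "\<dots> = sum h (set xs)"
    by (rule sum.reindex_bij_betw[OF bij_betw_nth[OF assms refl refl]])
  finally show ?thesis .
qed

section \<open>Cosets of the ideal, and operations on representatives\<close>

context
  fixes q :: complex and N :: nat
  assumes q: "q \<noteq> 0"
begin

interpretation quantum_matrix_congruence "carrier (free_matrix_algebra N)" "quantum_matrix_ideal q N"
  "scalar (- q)" "\<lambda>i j. var (i, j)" N
  by (rule quantum_matrix_congruence_free[OF q])

notation cong (infix "\<approx>" 50)

private abbreviation (input) "F \<equiv> free_matrix_algebra N"
private abbreviation (input) "M \<equiv> quantum_matrix_algebra q N"

definition coset_of :: "(nat \<times> nat) ncpoly \<Rightarrow> (nat \<times> nat) ncpoly set" where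
  "coset_of f = quantum_matrix_ideal q N +>\<^bsub>F\<^esub> f"

text \<open>Through this description of cosets, congruences in the free algebra become equalities in
  the quotient.\<close>

lemma mem_coset_of: "g \<in> coset_of f \<longleftrightarrow> g \<approx> f"
proof
  assume "g \<in> coset_of f"
  then show "g \<approx> f" by (auto simp: coset_of_def a_r_coset_def' cong_def)
next
  assume "g \<approx> f"
  then show "g \<in> coset_of f"
    by (auto simp: coset_of_def a_r_coset_def' cong_def intro!: bexI[of _ "g - f"])
qed

lemma coset_of_cong: "f \<approx> g \<Longrightarrow> coset_of f = coset_of g"
  by (intro Set.set_eqI) (metis mem_coset_of cong_trans cong_sym)

lemma coset_of_hom: "coset_of \<in> ring_hom F (F Quot quantum_matrix_ideal q N)"
  using ideal.rcos_ring_hom[OF ideal_quantum_matrix_ideal] unfolding coset_of_def .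

lemma coset_of_closed: "f \<in> carrier F \<Longrightarrow> coset_of f \<in> carrier M"
  using ring_hom_closed[OF coset_of_hom]
  by (simp add: quantum_matrix_algebra_def quotient_algebra_def)

lemma coset_of_add:
  "f \<in> carrier F \<Longrightarrow> g \<in> carrier F \<Longrightarrow> coset_of f \<oplus>\<^bsub>M\<^esub> coset_of g = coset_of (f + g)"
  using ring_hom_add[OF coset_of_hom, of f g]
  by (simp add: quantum_matrix_algebra_def quotient_algebra_def)

lemma coset_of_mult:
  "f \<in> carrier F \<Longrightarrow> g \<in> carrier F \<Longrightarrow> coset_of f \<otimes>\<^bsub>M\<^esub> coset_of g = coset_of (f * g)"
  using ring_hom_mult[OF coset_of_hom, of f g]
  by (simp add: quantum_matrix_algebra_def quotient_algebra_def)

lemma coset_of_one: "\<one>\<^bsub>M\<^esub> = coset_of 1"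
  using ring_hom_one[OF coset_of_hom]
  by (simp add: quantum_matrix_algebra_def quotient_algebra_def)

lemma coset_of_zero: "\<zero>\<^bsub>M\<^esub> = coset_of 0"
  by (auto simp: quantum_matrix_algebra_def quotient_algebra_def FactRing_def
      coset_of_def a_r_coset_def')

lemma scalar_F: "scalar c \<in> carrier F"
  unfolding free_matrix_algebra_def by (rule scalar_closed)

text \<open>Scalar multiplication in the quotient is a union over all representatives; they all give
  the same coset, and there is at least one.\<close>

lemma coset_of_smult: "c \<odot>\<^bsub>M\<^esub> coset_of f = coset_of (scalar c * f)"
proof -
  have "c \<odot>\<^bsub>M\<^esub> coset_of f = (\<Union>g\<in>coset_of f. coset_of (scalar c * g))"
    by (simp add: quantum_matrix_algebra_def quotient_algebra_def coset_of_def)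
  also have "\<dots> = (\<Union>g\<in>coset_of f. coset_of (scalar c * f))"
    by (intro SUP_cong refl coset_of_cong cong_mult_left scalar_F) (simp add: mem_coset_of)
  also have "\<dots> = coset_of (scalar c * f)"
    using mem_coset_of[of f f] by auto
  finally show ?thesis .
qed

lemma coset_of_minus:
  assumes "f \<in> carrier F" "g \<in> carrier F"
  shows "coset_of f \<ominus>\<^bsub>M\<^esub> coset_of g = coset_of (f - g)"
proof -
  interpret M: ring M by (rule ring_quantum_matrix_algebra)
  have g: "- g \<in> carrier F"
    using mult_C[OF scalar_F[of "- 1"] assms(2)] by (simp add: scalar_minus scalar_1)
  have "\<ominus>\<^bsub>M\<^esub> coset_of g = coset_of (- g)"
    by (rule M.minus_equality) (simp_all add: coset_of_add coset_of_closed g assms coset_of_zero)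
  then show ?thesis
    using coset_of_add[OF assms(1) g] by (simp add: a_minus_def)
qed

lemma coset_of_sum:
  assumes "\<And>x. x \<in> A \<Longrightarrow> g x = coset_of (f x)" "\<And>x. x \<in> A \<Longrightarrow> f x \<in> carrier F" "finite A"
  shows "(\<Oplus>\<^bsub>M\<^esub>x\<in>A. g x) = coset_of (sum f A)"
proof -
  interpret M: ring M by (rule ring_quantum_matrix_algebra)
  show ?thesis
    using assms(3,1,2)
  proof (induction A)
    case empty
    then show ?case by (simp add: coset_of_zero)
  next
    case (insert x A)
    have "g \<in> A \<rightarrow> carrier M" "g x \<in> carrier M"
      using coset_of_closed[OF insert.prems(2)] by (auto simp: insert.prems(1))
    then have "(\<Oplus>\<^bsub>M\<^esub>x\<in>insert x A. g x) = g x \<oplus>\<^bsub>M\<^esub> (\<Oplus>\<^bsub>M\<^esub>x\<in>A. g x)"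
      by (rule M.finsum_insert[OF insert.hyps])
    also have "(\<Oplus>\<^bsub>M\<^esub>x\<in>A. g x) = coset_of (sum f A)"
      using insert.prems by (intro insert.IH) auto
    also have "g x = coset_of (f x)" using insert.prems by simp
    also have "coset_of (f x) \<oplus>\<^bsub>M\<^esub> coset_of (sum f A) = coset_of (f x + sum f A)"
      using insert.prems by (intro coset_of_add sum_C) auto
    finally show ?case using insert.hyps by simp
  qed
qed

lemma coset_of_prod_list:
  assumes "\<And>x. x \<in> set l \<Longrightarrow> f x \<in> carrier F"
  shows "foldr (\<otimes>\<^bsub>M\<^esub>) (map (\<lambda>x. coset_of (f x)) l) \<one>\<^bsub>M\<^esub> = coset_of (prod_list (map f l))"
  using assms
proof (induction l)
  case Nil
  then show ?case by (simp add: coset_of_one)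
next
  case (Cons x l)
  have "prod_list (map f l) \<in> carrier F"
    by (rule prod_list_C) (use Cons.prems in simp)
  then show ?case using Cons by (simp add: coset_of_mult)
qed

section \<open>The determinant and the Pfaffian brackets as cosets of minors and their sums\<close>

lemma quantum_det_minor:
  "quantum_det M q N (quantum_matrix_gen q N) = coset_of (minor [1..<N + 1] {1..N})"
proof -
  have gen: "quantum_matrix_gen q N i j = coset_of (var (i, j))" for i j
    by (simp add: quantum_matrix_gen_def coset_of_def)
  have var: "var (i, \<sigma> i) \<in> carrier F" if "\<sigma> permutes {1..N}" "i \<in> set [1..<N + 1]" for \<sigma> i
  proof -
    have "i \<in> {1..N}" using that(2) by auto
    then show ?thesis using permutes_in_image[OF that(1), of i] by (intro a_C) auto
  qed
  show ?thesis
    unfolding quantum_det_def minor_permutes gen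
  proof (rule coset_of_sum)
    fix \<sigma> assume "\<sigma> \<in> {\<sigma>. \<sigma> permutes {1..N}}"
    then have \<sigma>: "\<And>i. i \<in> set [1..<N + 1] \<Longrightarrow> var (i, \<sigma> i) \<in> carrier F"
      using var by blast
    then show "scalar (- q) ^ inversions N \<sigma> * prod_list (map (\<lambda>i. var (i, \<sigma> i)) [1..<N + 1]) \<in> carrier F"
      by (intro mult_C power_C prod_list_C)
    show "(- q) ^ inversions N \<sigma> \<odot>\<^bsub>M\<^esub>
        foldr (\<otimes>\<^bsub>M\<^esub>) (map (\<lambda>i. coset_of (var (i, \<sigma> i))) [1..<N + 1]) \<one>\<^bsub>M\<^esub> =
      coset_of (scalar (- q) ^ inversions N \<sigma> * prod_list (map (\<lambda>i. var (i, \<sigma> i)) [1..<N + 1]))"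
      by (simp only: coset_of_prod_list[OF \<sigma>] coset_of_smult scalar_power)
  qed (simp add: finite_permutations)
qed

text \<open>One step of the Pfaffian recursion on representatives: \<open>u\<close> stands for the
  entries, \<open>v\<close> for the shorter brackets. The length \<open>2 * t + 3\<close> is that of
  the list without its first element \<open>c\<close>.\<close>

lemma pfaffian_bracket_Cons:
  assumes "sorted_wrt (<) (c # xs)" "length xs = 2 * t + 3"
    and "\<And>y. y \<in> set xs \<Longrightarrow> e c y = coset_of (u y)" "\<And>y. y \<in> set xs \<Longrightarrow> u y \<in> carrier F"
    and "\<And>y. y \<in> set xs \<Longrightarrow> pfaffian_bracket M q e (Suc t) (remove1 y xs) = coset_of (v y)"
    and "\<And>y. y \<in> set xs \<Longrightarrow> v y \<in> carrier F"
  shows "pfaffian_bracket M q e (Suc (Suc t)) (c # xs) =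
    coset_of (\<Sum>y\<in>set xs. scalar (- q) ^ rank (set xs) y * (u y * v y))"
proof -
  have dist: "distinct xs" using assms(1) by (simp add: strict_sorted_iff)
  let ?h = "\<lambda>y. scalar (- q) ^ rank (set xs) y * (u y * v y)"
  have "pfaffian_bracket M q e (Suc (Suc t)) (c # xs) =
      coset_of (\<Sum>k = 1..<2 * Suc (Suc t). ?h (xs ! (k - 1)))"
    unfolding pfaffian_bracket.simps
  proof (rule coset_of_sum)
    fix k assume k: "k \<in> {1..<2 * Suc (Suc t)}"
    then obtain i where i: "k = Suc i" "i < length xs"
      using assms(2) by (cases k) auto
    then have y: "xs ! i \<in> set xs" by simp
    show "?h (xs ! (k - 1)) \<in> carrier F"
      using y i assms(4,6) by (auto intro!: mult_C power_C)
    \<comment> \<open>Position \<open>k\<close> of \<open>c # xs\<close> is position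
      \<open>i = k - 1\<close> of \<open>xs\<close>. In a strictly sorted list this is the rank of
      the element, so the exponents agree.\<close>
    have "{j. Suc j \<in> - {0, k}} = - {i}" using i by auto
    then have "nths (c # xs) (- {0, k}) = remove1 (xs ! i) xs"
      using nths_remove_nth[OF dist i(2)] by (simp add: nths_Cons)
    moreover have "rank (set xs) (xs ! i) = i"
      using assms(1) i(2) by (intro rank_nth) auto
    ultimately show "(- q) ^ (k - 1) \<odot>\<^bsub>M\<^esub> (e ((c # xs) ! 0) ((c # xs) ! k) \<otimes>\<^bsub>M\<^esub>
        pfaffian_bracket M q e (Suc t) (nths (c # xs) (- {0, k}))) = coset_of (?h (xs ! (k - 1)))"
      using i y assms(3-6) by (simp add: coset_of_mult coset_of_smult scalar_power)
  qed simp
  also have "2 * Suc (Suc t) = Suc (length xs)" using assms(2) by simp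
  also have "(\<Sum>k = 1..<Suc (length xs). ?h (xs ! (k - 1))) = (\<Sum>y\<in>set xs. ?h y)"
    by (rule sum_nth[OF dist])
  finally show ?thesis .
qed

text \<open>By the induction hypothesis the recursion becomes the left-hand side of
  \<open>minor_sum_even\<close>; \<open>minor_sum_1\<close> starts the induction.\<close>

lemma pfaffian_bracket_even:
  assumes "2 * n \<le> N" "\<And>i j. 1 \<le> i \<Longrightarrow> i < j \<Longrightarrow> j \<le> N \<Longrightarrow> e i j = coset_of (pair_form n i j)"
    and "sorted_wrt (<) s" "set s \<subseteq> {1..N}" "length s = 2 * Suc t"
  shows "pfaffian_bracket M q e (Suc t) s = coset_of (minor_sum n (Suc t) {} (set s))"
  using assms(3-5)
proof (induction t arbitrary: s)
  case 0
  then obtain i j where s: "s = [i, j]"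
    by (metis (no_types, opaque_lifting) One_nat_def Suc_1 length_0_conv length_Suc_conv mult.right_neutral)
  then show ?case
    using 0 assms(2)[of i j] minor_sum_1[of i j n] by simp
next
  case (Suc t)
  then obtain c xs where s: "s = c # xs" by (cases s) auto
  have less: "c < y" if "y \<in> set xs" for y using Suc.prems(1) s that by simp
  have "pfaffian_bracket M q e (Suc (Suc t)) s =
      coset_of (\<Sum>y\<in>set xs. scalar (- q) ^ rank (set xs) y *
        (pair_form n c y * minor_sum n (Suc t) {} (set xs - {y})))"
    unfolding s
  proof (rule pfaffian_bracket_Cons)
    fix y assume y: "y \<in> set xs"
    show "e c y = coset_of (pair_form n c y)"
      using assms(2)[of c y] less[OF y] y Suc.prems(2) s by auto
    show "pair_form n c y \<in> carrier F"
      using y Suc.prems(2) s by (intro pair_form_C assms(1)) auto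
    show "minor_sum n (Suc t) {} (set xs - {y}) \<in> carrier F"
      using y Suc.prems(2) s by (intro minor_sum_C assms(1)) auto
    have "distinct xs" using Suc.prems(1) s by (simp add: strict_sorted_iff)
    then have set: "set (remove1 y xs) = set xs - {y}" by simp
    have "pfaffian_bracket M q e (Suc t) (remove1 y xs) =
        coset_of (minor_sum n (Suc t) {} (set (remove1 y xs)))"
    proof (rule Suc.IH)
      show "sorted_wrt (<) (remove1 y xs)"
        using Suc.prems(1) s \<open>distinct xs\<close> by (simp add: strict_sorted_iff sorted_remove1)
      show "length (remove1 y xs) = 2 * Suc t"
        using Suc.prems(3) s y by (simp add: length_remove1)
    qed (use set Suc.prems(2) s in auto)
    then show "pfaffian_bracket M q e (Suc t) (remove1 y xs) =
        coset_of (minor_sum n (Suc t) {} (set xs - {y}))"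
      by (simp only: set)
  qed (use Suc.prems s in auto)
  also have "\<dots> = coset_of (minor_sum n (Suc (Suc t)) {} (insert c (set xs)))"
    by (intro coset_of_cong minor_sum_even assms(1)) (use Suc.prems(2) s less in auto)
  finally show ?case by (simp add: s)
qed

text \<open>The recursion sum is split at the index \<open>Suc N\<close>: removing it leaves an even
  bracket, and removing any other index leaves a shorter bracket of the same kind. The two parts are
  those of \<open>minor_sum_odd\<close> with \<open>z = N\<close>.\<close>

lemma pfaffian_bracket_odd:
  assumes "N = 2 * n + 1" "\<And>i j. 1 \<le> i \<Longrightarrow> i < j \<Longrightarrow> j \<le> N \<Longrightarrow> e i j = coset_of (pair_form n i j)"
    and "\<And>i. 1 \<le> i \<Longrightarrow> i \<le> N \<Longrightarrow> e i (Suc N) = coset_of (var (N, i))"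
    and "sorted_wrt (<) s" "set s \<subseteq> {1..N}" "length s = 2 * t + 1"
  shows "pfaffian_bracket M q e (Suc t) (s @ [Suc N]) = coset_of (minor_sum n t {N} (set s))"
  using assms(4-6)
proof (induction t arbitrary: s)
  case 0
  then obtain i where s: "s = [i]" by (auto simp: length_Suc_conv)
  then show ?case
    using 0 assms(3)[of i] by (simp add: minor_sum_0)
next
  case (Suc t)
  then obtain c xs where s: "s = c # xs" by (cases s) auto
  have less: "c < y" if "y \<in> set xs" for y using Suc.prems(1) s that by simp
  have le: "y \<le> N" if "y \<in> set xs" for y using Suc.prems(2) s that by auto
  have c: "c \<in> {1..N}" using Suc.prems(2) s by simp
  have len: "length xs = 2 * Suc t" using Suc.prems(3) s by simp
  have sorted: "sorted_wrt (<) xs" using Suc.prems(1) s by simp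
  then have dist: "distinct xs" by (simp add: strict_sorted_iff)
  have notin: "Suc N \<notin> set xs" using le by fastforce
  have n: "2 * n \<le> N" "2 * n < N" using assms(1) by auto
  let ?u = "\<lambda>y. if y = Suc N then var (N, c) else pair_form n c y"
  let ?v = "\<lambda>y. if y = Suc N then minor_sum n (Suc t) {} (set xs) else minor_sum n t {N} (set xs - {y})"
  have "pfaffian_bracket M q e (Suc (Suc t)) (s @ [Suc N]) =
      coset_of (\<Sum>y\<in>set (xs @ [Suc N]). scalar (- q) ^ rank (set (xs @ [Suc N])) y * (?u y * ?v y))"
    unfolding s append_Cons
  proof (rule pfaffian_bracket_Cons)
    show "sorted_wrt (<) (c # xs @ [Suc N])"
      using Suc.prems(1) s le c by (fastforce simp: sorted_wrt_append)
    show "length (xs @ [Suc N]) = 2 * t + 3" using len by simp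
    fix y assume y: "y \<in> set (xs @ [Suc N])"
    show "e c y = coset_of (?u y)"
      using assms(2)[of c y] assms(3)[of c] less le c y by auto
    show "?u y \<in> carrier F"
      using y c le[of y] less[of y] by (auto intro!: pair_form_C n a_C)
    show "?v y \<in> carrier F"
      using n c Suc.prems(2) s by (auto intro!: minor_sum_C)
    show "pfaffian_bracket M q e (Suc t) (remove1 y (xs @ [Suc N])) = coset_of (?v y)"
    proof (cases "y = Suc N")
      case True
      then have "remove1 y (xs @ [Suc N]) = xs" using notin by (simp add: remove1_append)
      then show ?thesis
        using True pfaffian_bracket_even[OF n(1) assms(2) sorted _ len] Suc.prems(2) s by simp
    next
      case False
      then have y: "y \<in> set xs" using y by simp
      then have rem: "remove1 y (xs @ [Suc N]) = remove1 y xs @ [Suc N]" by (simp add: remove1_append)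
      have "pfaffian_bracket M q e (Suc t) (remove1 y xs @ [Suc N]) =
          coset_of (minor_sum n t {N} (set (remove1 y xs)))"
      proof (rule Suc.IH)
        show "sorted_wrt (<) (remove1 y xs)"
          using sorted by (simp add: strict_sorted_iff sorted_remove1)
        show "length (remove1 y xs) = 2 * t + 1" using len y by (simp add: length_remove1)
      qed (use dist Suc.prems(2) s in auto)
      then show ?thesis using False dist by (simp add: rem)
    qed
  qed
  also have "(\<Sum>y\<in>set (xs @ [Suc N]). scalar (- q) ^ rank (set (xs @ [Suc N])) y * (?u y * ?v y)) =
      (\<Sum>y\<in>set xs. scalar (- q) ^ rank (set xs) y * (pair_form n c y * minor_sum n t {N} (set xs - {y}))) +
      scalar (- q) ^ (2 * Suc t) * (var (N, c) * minor_sum n (Suc t) {} (set xs))"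
  proof -
    have set: "set (xs @ [Suc N]) = insert (Suc N) (set xs)" by auto
    \<comment> \<open>\<open>Suc N\<close> exceeds all \<open>2 * Suc t\<close> elements of
      \<open>xs\<close>. The same exponent belongs in \<open>minor_sum_odd\<close> to the row
      \<open>N\<close> below the pairs.\<close>
    have "{y \<in> insert (Suc N) (set xs). y < Suc N} = set xs" using le by (auto simp: less_Suc_eq_le)
    then have "rank (insert (Suc N) (set xs)) (Suc N) = 2 * Suc t"
      using len dist by (simp add: rank_def distinct_card)
    moreover have "rank (insert (Suc N) (set xs)) y = rank (set xs) y" if "y \<in> set xs" for y
      using le[OF that] by (intro rank_insert_ge) simp
    ultimately show ?thesis
      unfolding set using notin by (auto simp: add.commute intro!: sum.cong)
  qed
  also have "coset_of \<dots> = coset_of (minor_sum n (Suc t) {N} (insert c (set xs)))"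
    by (intro coset_of_cong minor_sum_odd) (use n Suc.prems(2) s less in auto)
  finally show ?case by (simp add: s)
qed

text \<open>The odd case with all columns and \<open>t = n\<close>: every pair of rows is used, and
  the single minor left is the quantum determinant. The entries \<open>e\<close> are prescribed at
  the pairs \<open>i < j\<close> that occur in the brackets.\<close>

lemma quantum_det_eq_quantum_pfaffian:
  assumes "N = 2 * n + 1" "\<And>i j. 1 \<le> i \<Longrightarrow> i < j \<Longrightarrow> j \<le> N \<Longrightarrow>
      e i j = (\<Oplus>\<^bsub>M\<^esub>m \<in> {1..n}.
         (quantum_matrix_gen q N (2 * m - 1) i \<otimes>\<^bsub>M\<^esub> quantum_matrix_gen q N (2 * m) j)
           \<ominus>\<^bsub>M\<^esub> (q \<odot>\<^bsub>M\<^esub> (quantum_matrix_gen q N (2 * m - 1) j \<otimes>\<^bsub>M\<^esub> quantum_matrix_gen q N (2 * m) i)))"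
    and "\<And>i. 1 \<le> i \<Longrightarrow> i \<le> N \<Longrightarrow> e i (Suc N) = quantum_matrix_gen q N N i"
  shows "quantum_det M q N (quantum_matrix_gen q N) = quantum_pfaffian M q (n + 1) e"
proof -
  have gen: "quantum_matrix_gen q N i j = coset_of (var (i, j))" for i j
    by (simp add: quantum_matrix_gen_def coset_of_def)
  have e: "e i j = coset_of (pair_form n i j)" if ij: "1 \<le> i" "i < j" "j \<le> N" for i j
    unfolding assms(2)[OF ij] gen pair_form_def
  proof (rule coset_of_sum)
    fix m assume m: "m \<in> {1..n}"
    then have v: "var (2 * m - 1, i) \<in> carrier F" "var (2 * m, j) \<in> carrier F"
      "var (2 * m - 1, j) \<in> carrier F" "var (2 * m, i) \<in> carrier F"
      using ij assms(1) by (intro a_C; auto)+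
    then show "var (2 * m - 1, i) * var (2 * m, j) + scalar (- q) * (var (2 * m - 1, j) * var (2 * m, i)) \<in> carrier F"
      by (intro add_C mult_C Q_C)
    show "coset_of (var (2 * m - 1, i)) \<otimes>\<^bsub>M\<^esub> coset_of (var (2 * m, j)) \<ominus>\<^bsub>M\<^esub>
        q \<odot>\<^bsub>M\<^esub> (coset_of (var (2 * m - 1, j)) \<otimes>\<^bsub>M\<^esub> coset_of (var (2 * m, i))) =
      coset_of (var (2 * m - 1, i) * var (2 * m, j) + scalar (- q) * (var (2 * m - 1, j) * var (2 * m, i)))"
      using v by (simp add: coset_of_mult coset_of_smult coset_of_minus mult_C scalar_F scalar_minus del: One_nat_def)
  qed simp
  have "[1..<2 * (n + 1) + 1] = [1..<N + 1] @ [Suc N]" using assms(1) by simp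
  then have "quantum_pfaffian M q (n + 1) e = pfaffian_bracket M q e (Suc n) ([1..<N + 1] @ [Suc N])"
    unfolding quantum_pfaffian_def by (simp del: upt_Suc)
  also have "\<dots> = coset_of (minor_sum n n {N} (set [1..<N + 1]))"
    using assms(1)
    by (intro pfaffian_bracket_odd[OF assms(1) e assms(3)[unfolded gen]]) (auto simp del: upt_Suc)
  also have "minor_sum n n {N} (set [1..<N + 1]) = minor [1..<N + 1] {1..N}"
    using minor_sum_full[of n "{1..N}"] assms(1) by (simp add: atLeastLessThanSuc_atLeastAtMost del: upt_Suc)
  finally show ?thesis by (simp only: quantum_det_minor)
qed

end

theorem corollary2p13:
  fixes q :: complex and n :: nat
    and M :: "(complex, (nat \<times> nat) ncpoly set) module"
    and a e :: "nat \<Rightarrow> nat \<Rightarrow> (nat \<times> nat) ncpoly set"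
  assumes "q \<noteq> 0" and "n \<ge> 1"
    and "M = quantum_matrix_algebra q (2 * n + 1)"
    and "a = quantum_matrix_gen q (2 * n + 1)"
    and "\<And>i j. 1 \<le> i \<Longrightarrow> i < j \<Longrightarrow> j \<le> 2 * n + 1 \<Longrightarrow>
           e i j = (\<Oplus>\<^bsub>M\<^esub>m \<in> {1..n}.
             (a (2 * m - 1) i \<otimes>\<^bsub>M\<^esub> a (2 * m) j)
               \<ominus>\<^bsub>M\<^esub> (q \<odot>\<^bsub>M\<^esub> (a (2 * m - 1) j \<otimes>\<^bsub>M\<^esub> a (2 * m) i)))"
    and "\<And>i. 1 \<le> i \<Longrightarrow> i \<le> 2 * n + 1 \<Longrightarrow> e i (2 * n + 2) = a (2 * n + 1) i"
  shows "quantum_det M q (2 * n + 1) a = quantum_pfaffian M q (n + 1) e"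
  unfolding assms(3,4)
  by (rule quantum_det_eq_quantum_pfaffian[OF assms(1) refl])
    (use assms(3-6) in auto)

end
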